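(* Let $\mathcal{G}$ be the path graph with one branch on $n$ vertices with incidence matrix $D$, let $S\subseteq\{2,\ldots,n\}$ with $s:=|S|$, let $\gamma>1$, and let an admissible decomposition of $\mathcal{G}$ into three path graphs with segment lengths $d^i_j$ be given, together with integers $u^i_j$ satisfying $2\le u^i_j\le d^i_j-2$ for $j\in\{2,\ldots,s_i\}$, $i\in\{1,2,3\}$. Let $D^*$ be the matrix obtained from $D$ by replacing with zeroes the entries of the rows corresponding to the edges connecting the three path graphs of the decomposition. Then the weighted compatibility constant satisfies $$\kappa_w^2(S)\ge\frac{s+1}{n}\frac{1}{(\sqrt{K^b}\,\|w\|_\infty+\|D^*w\|_2)^2}\ge\frac{s+1}{n}\frac{1}{2(K^b\|w\|_\infty^2+\|D^*w\|_2^2)}\ge\frac{s+1}{n}\frac{1}{2(K^b\|w\|_\infty^2+\|Dw\|_2^2)},$$ where $$K^b=\sum_{i=1}^3\left(\frac{1}{d^i_1}+\sum_{j=2}^{s_i}\left(\frac{1}{u^i_j}+\frac{1}{d^i_j-u^i_j}\right)+\frac{1}{d^i_{s_i+1}}\right).$$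
   Context: Branched path graph: $n=n_1+n_2$ vertices $1,\ldots,n$; edges $(i-1,i)$ for $2\le i\le n_1$ (main branch), $(b,n_1+1)$ with $1\le b<n_1$, and $(i-1,i)$ for $n_1+2\le i\le n$ (side branch). It is rooted at vertex $1$, each vertex $i\ge2$ has a parent $\mathrm{pa}(i)$ (its neighbour towards the root), and the edge from the parent to $i$ is indexed by $i$; thus $S\subseteq\{2,\ldots,n\}$ is a set of edges. The incidence matrix $D\in\mathbb{R}^{(n-1)\times n}$ acts by $(Df)_i=f_i-f_{\mathrm{pa}(i)}$, $i=2,\ldots,n$. Path matrix: $X\in\mathbb{R}^{n\times n}$, $X_{ij}=1$ if $j$ lies on the path from $1$ to $i$ (endpoints included), $0$ otherwise; $X_j$ is its $j$-th column. Weights: $\Pi_{\{1\}\cup S}$ is the orthogonal projection onto the span of the columns $X_j$, $j\in\{1\}\cup S$; $\omega_j=\|X_j'(I_n-\Pi_{\{1\}\cup S})\|_2/\sqrt n$, and $w\in\mathbb{R}^n$ has entries $w_j=1-\omega_j/\gamma$. Weighted compatibility constant: with $\|v\|_n^2=\frac1n\sum_iv_i^2$ and $\odot$ the entrywise product, $$\kappa_w^2(S):=\min\{(s+1)\|X\beta\|_n^2:\ \beta\in\mathbb{R}^n,\ \|(w\odot\beta)_S\|_1-\|(w\odot\beta)_{-(\{1\}\cup S)}\|_1=1\},$$ where $-(\{1\}\cup S)$ denotes the complement in $\{1,\ldots,n\}$. Admissible decomposition: $S$ is partitioned as $S_1=S\cap\{2,\ldots,b\}$, $S_2=S\cap\{b+1,\ldots,n_1\}$,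 $S_3=S\cap\{n_1+1,\ldots,n\}$, with $s_i=|S_i|\ge1$. By removing two edges not in $S$, the graph is decomposed into three vertex-disjoint path graphs $P^1,P^2,P^3$ covering all vertices, such that $P^i$ contains exactly the edges of $S$ lying in $S_i$; $P^1$ starts at vertex $1$, $P^2$ ends at vertex $n_1$, $P^3$ ends at vertex $n$. (The end of $P^1$ need not be $b$, and the starting points of $P^2,P^3$ need not be $b+1,n_1+1$.) Traversing $P^i$ in this direction, removal of the edges in $S_i$ cuts $P^i$ into $s_i+1$ consecutive segments with $d^i_1,\ldots,d^i_{s_i+1}$ vertices (so $\sum_i\sum_jd^i_j=n$). It is required that $d^i_1\ge2$, $d^i_{s_i+1}\ge2$ and $d^i_j\ge4$ for $2\le j\le s_i$, for every $i$. The edges connecting the three path graphs are the two removed edges. *)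

theory Defs
  imports "HOL-Analysis.Analysis"
begin

text \<open>
  Vectors and matrices are functions on \<open>nat\<close>, used only at the indices \<open>{1..n}\<close>, so that the
  numbering of the vertices (and of the edges, \<open>{2..n}\<close>) is kept literally.
\<close>

definition mat_vec :: "nat \<Rightarrow> (nat \<Rightarrow> nat \<Rightarrow> real) \<Rightarrow> (nat \<Rightarrow> real) \<Rightarrow> nat \<Rightarrow> real" where
  "mat_vec n M v = (\<lambda>i. \<Sum>k\<in>{1..n}. M i k * v k)"

definition sup_norm :: "nat \<Rightarrow> (nat \<Rightarrow> real) \<Rightarrow> real" where
  "sup_norm n v = Max ((\<lambda>i. \<bar>v i\<bar>) ` {1..n})"

definition sq_norm_n :: "nat \<Rightarrow> (nat \<Rightarrow> real) \<Rightarrow> real" where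
  "sq_norm_n n v = (1 / real n) * (\<Sum>i\<in>{1..n}. (v i)\<^sup>2)"


subsection \<open>The branched path graph\<close>

text \<open>
  The vertices are \<open>{1..n1 + n2}\<close>.  The edge with index \<open>i \<in> {2..n1 + n2}\<close> joins the parent of
  \<open>i\<close> to \<open>i\<close>; vertex \<open>1\<close> is the root, and \<open>pa n1 b 1\<close> is never used.
\<close>

definition pa :: "nat \<Rightarrow> nat \<Rightarrow> nat \<Rightarrow> nat" where
  "pa n1 b i = (if i = n1 + 1 then b else i - 1)"

definition adj :: "nat \<Rightarrow> nat \<Rightarrow> nat \<Rightarrow> nat \<Rightarrow> nat \<Rightarrow> bool" where
  "adj n1 n2 b u v \<longleftrightarrow> (\<exists>i\<in>{2..n1 + n2}. {u, v} = {pa n1 b i, i})"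

definition is_path :: "nat \<Rightarrow> nat \<Rightarrow> nat \<Rightarrow> nat list \<Rightarrow> bool" where
  "is_path n1 n2 b xs \<longleftrightarrow>
     xs \<noteq> [] \<and> set xs \<subseteq> {1..n1 + n2} \<and> distinct xs \<and> successively (adj n1 n2 b) xs"

definition path_edges :: "nat \<Rightarrow> nat \<Rightarrow> nat \<Rightarrow> nat list \<Rightarrow> nat set" where
  "path_edges n1 n2 b xs =
     {i \<in> {2..n1 + n2}. \<exists>k. Suc k < length xs \<and> {xs ! k, xs ! Suc k} = {pa n1 b i, i}}"

text \<open>Incidence matrix, with rows \<open>i \<in> {2..n1 + n2}\<close> and columns \<open>{1..n1 + n2}\<close>.\<close>

definition inc_mat :: "nat \<Rightarrow> nat \<Rightarrow> nat \<Rightarrow> nat \<Rightarrow> real" where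
  "inc_mat n1 b i k = (if k = i then 1 else 0) - (if k = pa n1 b i then 1 else 0)"

definition zero_rows :: "nat set \<Rightarrow> (nat \<Rightarrow> nat \<Rightarrow> real) \<Rightarrow> nat \<Rightarrow> nat \<Rightarrow> real" where
  "zero_rows R M i k = (if i \<in> R then 0 else M i k)"

definition path_mat :: "nat \<Rightarrow> nat \<Rightarrow> nat \<Rightarrow> nat \<Rightarrow> nat \<Rightarrow> real" where
  "path_mat n1 n2 b i j =
     (if \<exists>xs. is_path n1 n2 b xs \<and> hd xs = 1 \<and> last xs = i \<and> j \<in> set xs then 1 else 0)"


subsection \<open>Projection, weights, compatibility constant\<close>

definition col_span :: "(nat \<Rightarrow> nat \<Rightarrow> real) \<Rightarrow> nat set \<Rightarrow> (nat \<Rightarrow> real) set" where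
  "col_span M J = {v. \<exists>c. v = (\<lambda>i. \<Sum>j\<in>J. c j * M i j)}"

definition is_orth_proj :: "nat \<Rightarrow> (nat \<Rightarrow> real) set \<Rightarrow> (nat \<Rightarrow> nat \<Rightarrow> real) \<Rightarrow> bool" where
  "is_orth_proj n V P \<longleftrightarrow>
     (\<forall>i k. i \<notin> {1..n} \<or> k \<notin> {1..n} \<longrightarrow> P i k = 0) \<and>
     (\<forall>v. mat_vec n P v \<in> V \<and> (\<forall>u\<in>V. (\<Sum>i\<in>{1..n}. (v i - mat_vec n P v i) * u i) = 0))"

text \<open>
  For the subspaces spanned by columns of the path matrix (which vanish outside \<open>{1..n}\<close>),
  exactly one matrix satisfies \<^const>\<open>is_orth_proj\<close>.
\<close>

definition orth_proj :: "nat \<Rightarrow> (nat \<Rightarrow> real) set \<Rightarrow> nat \<Rightarrow> nat \<Rightarrow> real" where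
  "orth_proj n V = (THE P. is_orth_proj n V P)"

definition omega :: "nat \<Rightarrow> nat \<Rightarrow> nat \<Rightarrow> nat set \<Rightarrow> nat \<Rightarrow> real" where
  "omega n1 n2 b S j =
     (let n = n1 + n2; X = path_mat n1 n2 b; P = orth_proj n (col_span X ({1} \<union> S))
      in L2_set (\<lambda>k. \<Sum>i\<in>{1..n}. X i j * ((if i = k then 1 else 0) - P i k)) {1..n}
           / sqrt (real n))"

definition weight :: "nat \<Rightarrow> nat \<Rightarrow> nat \<Rightarrow> nat set \<Rightarrow> real \<Rightarrow> nat \<Rightarrow> real" where
  "weight n1 n2 b S \<gamma> j = 1 - omega n1 n2 b S j / \<gamma>"

text \<open>
  \<open>LEAST\<close> on \<open>real\<close> is the minimum of the set; it exists as soon as \<open>S \<noteq> {}\<close> and \<open>w\<close> is nonzero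
  on \<open>S\<close>, because the path matrix is invertible.
\<close>

definition kappa_sq :: "nat \<Rightarrow> nat \<Rightarrow> nat \<Rightarrow> (nat \<Rightarrow> real) \<Rightarrow> nat set \<Rightarrow> real" where
  "kappa_sq n1 n2 b w S =
     (LEAST r. \<exists>\<beta> :: nat \<Rightarrow> real.
        (\<Sum>j\<in>S. \<bar>w j * \<beta> j\<bar>) - (\<Sum>j\<in>{1..n1 + n2} - ({1} \<union> S). \<bar>w j * \<beta> j\<bar>) = 1 \<and>
        r = (real (card S) + 1) * sq_norm_n (n1 + n2) (mat_vec (n1 + n2) (path_mat n1 n2 b) \<beta>))"


subsection \<open>Admissible decompositions\<close>

definition S_part :: "nat \<Rightarrow> nat \<Rightarrow> nat \<Rightarrow> nat set \<Rightarrow> nat \<Rightarrow> nat set" where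
  "S_part n1 n2 b S i =
     (if i = 1 then S \<inter> {2..b} else if i = 2 then S \<inter> {b + 1..n1} else S \<inter> {n1 + 1..n1 + n2})"

text \<open>\<open>yss\<close> lists the consecutive segments into which removal of the edges in \<open>S\<close> cuts \<open>xs\<close>.\<close>

definition is_segmentation ::
    "nat \<Rightarrow> nat \<Rightarrow> nat \<Rightarrow> nat set \<Rightarrow> nat list \<Rightarrow> nat list list \<Rightarrow> bool" where
  "is_segmentation n1 n2 b S xs yss \<longleftrightarrow>
     concat yss = xs \<and> [] \<notin> set yss \<and>
     (\<forall>ys\<in>set yss. path_edges n1 n2 b ys \<inter> S = {}) \<and>
     (\<forall>j. Suc j < length yss \<longrightarrow>
        (\<exists>i\<in>S. {last (yss ! j), hd (yss ! Suc j)} = {pa n1 b i, i}))"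

definition connecting_edges :: "nat \<Rightarrow> nat \<Rightarrow> nat \<Rightarrow> (nat \<Rightarrow> nat list) \<Rightarrow> nat set" where
  "connecting_edges n1 n2 b P = {2..n1 + n2} - (\<Union>i\<in>{1,2,3}. path_edges n1 n2 b (P i))"

text \<open>
  \<open>P i\<close> is the vertex sequence of the \<open>i\<close>-th path graph (in its direction of traversal) and
  \<open>d i j\<close> the number of vertices of its \<open>j\<close>-th segment.  The path graphs are arbitrary subgraphs
  of the undirected graph; in particular the first edges of \<open>P 2\<close> or \<open>P 3\<close> may lead towards the
  root.
\<close>

definition admissible_decomposition ::
    "nat \<Rightarrow> nat \<Rightarrow> nat \<Rightarrow> nat set \<Rightarrow> (nat \<Rightarrow> nat list) \<Rightarrow> (nat \<Rightarrow> nat \<Rightarrow> nat) \<Rightarrow> bool" where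
  "admissible_decomposition n1 n2 b S P d \<longleftrightarrow>
     (\<forall>i\<in>{1,2,3}. is_path n1 n2 b (P i)) \<and>
     disjoint_family_on (\<lambda>i. set (P i)) {1,2,3} \<and>
     (\<Union>i\<in>{1,2,3}. set (P i)) = {1..n1 + n2} \<and>
     card (connecting_edges n1 n2 b P) = 2 \<and>
     connecting_edges n1 n2 b P \<inter> S = {} \<and>
     hd (P 1) = 1 \<and> last (P 2) = n1 \<and> last (P 3) = n1 + n2 \<and>
     (\<forall>i\<in>{1,2,3}.
        let s\<^sub>i = card (S_part n1 n2 b S i) in
        s\<^sub>i \<ge> 1 \<and>
        path_edges n1 n2 b (P i) \<inter> S = S_part n1 n2 b S i \<and>
        (\<exists>yss. is_segmentation n1 n2 b S (P i) yss \<and> length yss = s\<^sub>i + 1 \<and>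
           (\<forall>j\<in>{1..s\<^sub>i + 1}. d i j = length (yss ! (j - 1)))) \<and>
        d i 1 \<ge> 2 \<and> d i (s\<^sub>i + 1) \<ge> 2 \<and> (\<forall>j\<in>{2..s\<^sub>i}. d i j \<ge> 4))"

definition K_branch ::
    "(nat \<Rightarrow> nat) \<Rightarrow> (nat \<Rightarrow> nat \<Rightarrow> nat) \<Rightarrow> (nat \<Rightarrow> nat \<Rightarrow> nat) \<Rightarrow> real" where
  "K_branch s d u =
     (\<Sum>i\<in>{1,2,3}. 1 / real (d i 1)
        + (\<Sum>j\<in>{2..s i}. 1 / real (u i j) + 1 / (real (d i j) - real (u i j)))
        + 1 / real (d i (s i + 1)))"

end

theory Submission
  imports Defs
begin

text \<open>
  Put \<open>f = X \<beta>\<close>. The path matrix sums coefficients along paths from the root, so \<open>\<beta> j = f j - f (pa j)\<close>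
  for every edge \<open>j\<close>, and what has to be shown is that the increments of \<open>f\<close> over the edges of \<open>S\<close>,
  reduced by the weighted increments over the other edges, are at most
  \<open>(sqrt K * |w|\<^sub>\<infinity> + |D* w|\<^sub>2) * |f|\<^sub>2\<close>. Weights are \<open>1\<close> on \<open>S\<close>, since the columns of \<open>S\<close> belong to the
  span from which the distances are taken.

  An increment over an edge of \<open>S\<close> is at most the sum of the absolute values of \<open>f\<close> at its ends. From each
  end a ray of vertices extends into the adjacent segment, up to the cut prescribed by \<open>u\<close> or to the end
  of the path graph. All these rays are disjoint, and the reciprocals of their lengths add up to \<open>K\<close>.
  On a ray with \<open>m\<close> vertices, summation by parts against a profile that runs from \<open>1\<close> to \<open>0\<close> and
  remains below the weights bounds the value of \<open>f\<close> at the start by the weighted increments on the ray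
  plus the norm of \<open>f\<close> on it times the root of the energy of the profile (\<open>end_value_bound\<close>). For the
  minimum of the linear ramp and the weights, the energy is at most \<open>1 / m\<close> plus the squared increments
  of the weights. The latter are entries of \<open>D* w\<close>, different ones for different rays, and so the
  Cauchy-Schwarz inequality over all rays would yield even the factor \<open>sqrt (K + |D* w|\<^sup>2)\<close>.

  The exception is a ray that climbs to the branching vertex \<open>b\<close> and descends into the other branch,
  which happens when the first edges of a path graph lead towards the root. At \<open>b\<close> two edges with the
  same parent follow each other, and their weights differ by the difference of two entries of \<open>D* w\<close>, whose
  square may exceed the sum of the squares. The profile is then lowered gradually before \<open>b\<close>
  (\<open>skip_profile_energy\<close>). The price depends on how much the weight drops from \<open>b\<close> to its child in the
  other branch; as distances from a subspace are 1-Lipschitz, the drop is at most \<open>sqrt (q / n)\<close>, where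
  \<open>q\<close> is the number of vertices climbed through (\<open>weight_drop_at_branching\<close>). This makes the excess at most
  \<open>2 * |D* w| / sqrt n\<close>, for one ray only, and the cross term \<open>2 * sqrt K * |D* w|\<close> in the square of
  \<open>sqrt K + |D* w|\<close> is at least as large (\<open>ray_family_bound\<close>).

  Two points of rigour remain: the orthogonal projection in the definition of the weights exists, is unique
  and is symmetric (\<open>orth_proj_facts\<close>), and the minimum defining the compatibility constant is attained
  (\<open>kappa_sq_attained\<close>).
\<close>

section \<open>Profiles along a sequence of vertices\<close>

lemma summation_by_parts:
  fixes g t :: "nat \<Rightarrow> real"
  shows "(\<Sum>k\<le>M. (t k - t (Suc k)) * g k)
       = t 0 * g 0 + (\<Sum>k<M. t (Suc k) * (g (Suc k) - g k)) - t (Suc M) * g M"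
  by (induction M) (auto simp: algebra_simps)

text \<open>
  Clipping and taking minima are contractions for the maximum norm. Hence a minimum of two sequences
  has squared increments bounded by the sum of the squared increments of both, without the cross
  term that a product of the two sequences would cause.
\<close>

lemma clipped_min_diff_sq_le:
  fixes l l' c c' :: real
  shows "(max 0 (min l c) - max 0 (min l' c'))\<^sup>2 \<le> (l - l')\<^sup>2 + (c - c')\<^sup>2"
proof -
  have "\<bar>max 0 (min l c) - max 0 (min l' c')\<bar> \<le> max \<bar>l - l'\<bar> \<bar>c - c'\<bar>"
    by (auto simp: max_def min_def abs_if)
  then consider "\<bar>max 0 (min l c) - max 0 (min l' c')\<bar> \<le> \<bar>l - l'\<bar>"
    | "\<bar>max 0 (min l c) - max 0 (min l' c')\<bar> \<le> \<bar>c - c'\<bar>"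
    by linarith
  then show ?thesis
  proof cases
    case 1
    then show ?thesis unfolding abs_le_square_iff by (smt (verit) zero_le_power2)
  next
    case 2
    then show ?thesis unfolding abs_le_square_iff by (smt (verit) zero_le_power2)
  qed
qed

text \<open>
  The value of \<open>g\<close> at the start of a sequence of \<open>Suc M\<close> vertices is paid for in two ways: by
  the increments of \<open>g\<close>, at the price \<open>e\<close>, and by the size of \<open>g\<close>. The exchange is a summation by
  parts against a profile that starts at \<open>1\<close>, vanishes after the last vertex and stays below \<open>e\<close>; the
  profile used is the minimum of the linear ramp and of \<open>c\<close>, whose energy is at most the sum of the
  energies of the ramp, \<open>1 / Suc M\<close>, and of \<open>c\<close>.
\<close>

lemma end_value_bound:
  fixes g c e :: "nat \<Rightarrow> real"
  assumes c0: "c 0 = 1" and ce: "\<And>k. k \<le> M \<Longrightarrow> c k \<le> e k" and e0: "\<And>k. k \<le> M \<Longrightarrow> 0 \<le> e k"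
  shows "\<bar>g 0\<bar> \<le> (\<Sum>k<M. e (Suc k) * \<bar>g (Suc k) - g k\<bar>)
     + sqrt (1 / real (Suc M) + (\<Sum>k<M. (c k - c (Suc k))\<^sup>2)) * sqrt (\<Sum>k\<le>M. (g k)\<^sup>2)"
proof -
  define l where "l k = 1 - real k / real (Suc M)" for k
  define t where "t k = max 0 (min (l k) (c k))" for k
  have t0: "t 0 = 1" and tM: "t (Suc M) = 0"
    by (auto simp: t_def l_def c0)
  have te: "\<bar>t k\<bar> \<le> e k" if "k \<le> M" for k
    using ce[OF that] e0[OF that] by (auto simp: t_def)
  have step: "(l k - l (Suc k))\<^sup>2 = (1 / real (Suc M))\<^sup>2" for k
    by (simp add: l_def field_simps)
  have last: "(t M - t (Suc M))\<^sup>2 \<le> (1 / real (Suc M))\<^sup>2"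
  proof -
    have "0 \<le> t M" "t M \<le> 1 / real (Suc M)"
      by (auto simp: t_def l_def field_simps min_def)
    then show ?thesis unfolding tM by (simp add: power_mono)
  qed
  have "(\<Sum>k\<le>M. (t k - t (Suc k))\<^sup>2) = (\<Sum>k<M. (t k - t (Suc k))\<^sup>2) + (t M - t (Suc M))\<^sup>2"
    by (simp add: lessThan_Suc_atMost[symmetric])
  also have "\<dots> \<le> (\<Sum>k<M. (1 / real (Suc M))\<^sup>2 + (c k - c (Suc k))\<^sup>2) + (1 / real (Suc M))\<^sup>2"
    using clipped_min_diff_sq_le[of "l k" "c k" "l (Suc k)" "c (Suc k)" for k] last
    by (intro add_mono sum_mono) (auto simp: t_def step)
  also have "\<dots> = 1 / real (Suc M) + (\<Sum>k<M. (c k - c (Suc k))\<^sup>2)"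
  proof -
    have "(\<Sum>k<M. x) + x = real (Suc M) * x" for x :: real
      by (simp add: distrib_right)
    then have "(\<Sum>k<M. (1 / real (Suc M))\<^sup>2) + (1 / real (Suc M))\<^sup>2 = real (Suc M) * (1 / real (Suc M))\<^sup>2" .
    also have "\<dots> = 1 / real (Suc M)" by (simp add: power2_eq_square)
    finally show ?thesis by (simp add: sum.distrib)
  qed
  finally have energy: "(\<Sum>k\<le>M. (t k - t (Suc k))\<^sup>2)
      \<le> 1 / real (Suc M) + (\<Sum>k<M. (c k - c (Suc k))\<^sup>2)" .
  have "g 0 = (\<Sum>k\<le>M. (t k - t (Suc k)) * g k) - (\<Sum>k<M. t (Suc k) * (g (Suc k) - g k))"
    using summation_by_parts[of t g M] by (simp add: t0 tM)
  then have "\<bar>g 0\<bar> \<le> \<bar>\<Sum>k\<le>M. (t k - t (Suc k)) * g k\<bar> + \<bar>\<Sum>k<M. t (Suc k) * (g (Suc k) - g k)\<bar>"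
    by linarith
  moreover have "\<bar>\<Sum>k<M. t (Suc k) * (g (Suc k) - g k)\<bar> \<le> (\<Sum>k<M. e (Suc k) * \<bar>g (Suc k) - g k\<bar>)"
    by (rule order_trans[OF sum_abs]) (auto intro!: sum_mono mult_right_mono te simp: abs_mult)
  moreover have "\<bar>\<Sum>k\<le>M. (t k - t (Suc k)) * g k\<bar>
      \<le> sqrt (1 / real (Suc M) + (\<Sum>k<M. (c k - c (Suc k))\<^sup>2)) * sqrt (\<Sum>k\<le>M. (g k)\<^sup>2)"
  proof -
    have "(\<Sum>k\<le>M. (t k - t (Suc k)) * g k)\<^sup>2 \<le> (\<Sum>k\<le>M. (t k - t (Suc k))\<^sup>2) * (\<Sum>k\<le>M. (g k)\<^sup>2)"
      by (rule Cauchy_Schwarz_ineq_sum)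
    also have "\<dots> \<le> (1 / real (Suc M) + (\<Sum>k<M. (c k - c (Suc k))\<^sup>2)) * (\<Sum>k\<le>M. (g k)\<^sup>2)"
      by (intro mult_right_mono energy sum_nonneg) auto
    finally show ?thesis
      unfolding real_sqrt_mult[symmetric] by (rule real_le_rsqrt[of "\<bar>_\<bar>", unfolded power2_abs])
  qed
  ultimately show ?thesis by linarith
qed

text \<open>
  If \<open>a\<close> lists the weights of the vertices of a path that climbs during \<open>q\<close> steps and descends
  afterwards, its edges carry the weights \<open>a 0, \<dots>, a (q - 1), a (q + 1), \<dots>\<close>: the value \<open>a q\<close> of the
  turning point is skipped. The profile below stays under these edge weights. Its second part is capped at \<open>a q\<close>; if
  \<open>a (q + 1)\<close> is smaller than \<open>a q\<close>, the missing amount is subtracted from the first part gradually,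
  linearly in the number of steps from the start.
\<close>

definition skip_profile :: "(nat \<Rightarrow> real) \<Rightarrow> nat \<Rightarrow> nat \<Rightarrow> real" where
  "skip_profile a q k =
     (if k < q then a k - max 0 (a q - a (Suc q)) * (real k / real q) else min (a (Suc k)) (a q))"

text \<open>
  The skipped value costs at the turning point the square of a sum of two increments of \<open>a\<close> instead
  of the sum of their squares. Spreading the drop \<open>y\<close> over the \<open>q\<close> climbing steps adds \<open>y / q\<close> to
  each of the increments; the resulting cross term is \<open>2 y / q\<close> times \<open>a 0 - a q\<close>, which the
  Cauchy-Schwarz inequality bounds by \<open>sqrt (q * Q)\<close>, and the quadratic term is at most the square of
  the increment of \<open>a\<close> from \<open>q\<close> to \<open>q + 1\<close>, which the capped second part leaves unused.
\<close>

lemma skip_profile_energy: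
  fixes a :: "nat \<Rightarrow> real"
  assumes q: "1 \<le> q" "q \<le> M"
  defines "Q \<equiv> \<Sum>k\<le>M. (a k - a (Suc k))\<^sup>2"
  shows "(\<Sum>k<M. (skip_profile a q k - skip_profile a q (Suc k))\<^sup>2)
     \<le> Q + 2 * (max 0 (a q - a (Suc q)) / sqrt (real q)) * sqrt Q"
proof -
  define y where "y = max 0 (a q - a (Suc q))"
  define c where "c = skip_profile a q"
  have c_def': "c k = (if k < q then a k - y * (real k / real q) else min (a (Suc k)) (a q))" for k
    by (simp add: c_def skip_profile_def y_def)
  have y0: "0 \<le> y" and ysq: "y\<^sup>2 \<le> (a q - a (Suc q))\<^sup>2"
    by (auto simp: y_def max_def)
  define Z where "Z = (\<Sum>k<q. (a k - a (Suc k))\<^sup>2)"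
  have Qsplit: "Q = Z + (a q - a (Suc q))\<^sup>2 + (\<Sum>k\<in>{q<..M}. (a k - a (Suc k))\<^sup>2)"
  proof -
    have "{..M} = insert q ({..<q} \<union> {q<..M})" using q by auto
    then have "Q = sum h (insert q ({..<q} \<union> {q<..M}))" if "h = (\<lambda>k. (a k - a (Suc k))\<^sup>2)" for h
      by (simp only: Q_def that)
    moreover have "sum h (insert q ({..<q} \<union> {q<..M})) = sum h {..<q} + h q + sum h {q<..M}"
      for h :: "nat \<Rightarrow> real"
    proof -
      have "sum h ({..<q} \<union> {q<..M}) = sum h {..<q} + sum h {q<..M}"
        by (rule sum.union_disjoint) auto
      then show ?thesis by (subst sum.insert) auto
    qed
    ultimately show ?thesis unfolding Z_def by blast
  qed
  have up: "c k - c (Suc k) = (a k - a (Suc k)) + y / real q" if "k < q" for k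
  proof (cases "Suc k = q")
    case True
    have "min (a (Suc q)) (a q) = a q - y" by (auto simp: y_def)
    moreover have "real k / real q = 1 - 1 / real q" using True q by (auto simp: field_simps)
    ultimately show ?thesis using True that by (simp add: c_def' right_diff_distrib)
  next
    case False
    then show ?thesis using that q by (simp add: c_def' field_simps)
  qed
  have down: "(c k - c (Suc k))\<^sup>2 \<le> (a (Suc k) - a (Suc (Suc k)))\<^sup>2" if "q \<le> k" for k
    using that unfolding abs_le_square_iff[symmetric] by (auto simp: c_def' min_def)
  have "(\<Sum>k<M. (c k - c (Suc k))\<^sup>2)
      = (\<Sum>k<q. (c k - c (Suc k))\<^sup>2) + (\<Sum>k\<in>{q..<M}. (c k - c (Suc k))\<^sup>2)"
    using q(2) sum.union_disjoint[of "{..<q}" "{q..<M}"] by (simp add: ivl_disj_un_one ivl_disj_int_one)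
  also have "\<dots> \<le> (\<Sum>k<q. ((a k - a (Suc k)) + y / real q)\<^sup>2)
      + (\<Sum>k\<in>{q..<M}. (a (Suc k) - a (Suc (Suc k)))\<^sup>2)"
    by (intro add_mono sum_mono) (auto simp: up down)
  also have "(\<Sum>k\<in>{q..<M}. (a (Suc k) - a (Suc (Suc k)))\<^sup>2) = (\<Sum>k\<in>{q<..M}. (a k - a (Suc k))\<^sup>2)"
    by (rule sum.reindex_bij_witness[of _ "\<lambda>k. k - 1" Suc]) auto
  also have "(\<Sum>k<q. ((a k - a (Suc k)) + y / real q)\<^sup>2)
      = Z + 2 * (y / real q) * (a 0 - a q) + y\<^sup>2 / real q"
  proof -
    have "(\<Sum>k<q. ((a k - a (Suc k)) + y / real q)\<^sup>2)
        = (\<Sum>k<q. (a k - a (Suc k))\<^sup>2 + 2 * (y / real q) * (a k - a (Suc k)) + (y / real q)\<^sup>2)"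
      by (intro sum.cong refl) (simp only: power2_sum, simp)
    also have "\<dots> = Z + 2 * (y / real q) * (\<Sum>k<q. a k - a (Suc k)) + real q * (y / real q)\<^sup>2"
      by (simp add: sum.distrib sum_distrib_left Z_def)
    also have "(\<Sum>k<q. a k - a (Suc k)) = a 0 - a q" by (rule sum_lessThan_telescope')
    also have "real q * (y / real q)\<^sup>2 = y\<^sup>2 / real q" by (simp add: power2_eq_square)
    finally show ?thesis .
  qed
  also have "y\<^sup>2 / real q \<le> (a q - a (Suc q))\<^sup>2"
  proof -
    have "y\<^sup>2 / real q \<le> y\<^sup>2 / 1" using q by (intro divide_left_mono) auto
    then show ?thesis using ysq by simp
  qed
  also have "2 * (y / real q) * (a 0 - a q) \<le> 2 * (y / sqrt (real q)) * sqrt Q"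
  proof -
    have "(\<Sum>k<q. 1 * (a k - a (Suc k)))\<^sup>2 \<le> (\<Sum>k<q. 1\<^sup>2) * Z"
      unfolding Z_def by (rule Cauchy_Schwarz_ineq_sum)
    moreover have "Z \<le> Q" unfolding Qsplit by (simp add: sum_nonneg)
    moreover have "(\<Sum>k<q. a k - a (Suc k)) = a 0 - a q" by (rule sum_lessThan_telescope')
    ultimately have "(a 0 - a q)\<^sup>2 \<le> real q * Q"
      using mult_left_mono[of Z Q "real q"] by simp
    then have "a 0 - a q \<le> sqrt (real q) * sqrt Q"
      unfolding real_sqrt_mult[symmetric] by (rule real_le_rsqrt)
    then have "2 * (y / real q) * (a 0 - a q) \<le> 2 * (y / real q) * (sqrt (real q) * sqrt Q)"
      using y0 by (intro mult_left_mono) auto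
    also have "\<dots> = 2 * (y / sqrt (real q)) * sqrt Q"
      using q by (auto simp: divide_simps)
    finally show ?thesis .
  qed
  finally show ?thesis unfolding Qsplit c_def y_def by simp
qed

section \<open>The rooted tree\<close>

lemma is_path_rev: "is_path n1 n2 b (rev xs) = is_path n1 n2 b xs"
proof -
  have "adj n1 n2 b u v = adj n1 n2 b v u" for u v by (auto simp: adj_def insert_commute)
  then show ?thesis by (simp add: is_path_def)
qed

lemma is_path_sublist:
  assumes "is_path n1 n2 b (ps @ ys @ ss)" "ys \<noteq> []"
  shows "is_path n1 n2 b ys"
  using assms by (auto simp: is_path_def successively_append_iff)

lemma path_edges_sublist:
  "path_edges n1 n2 b ys \<subseteq> path_edges n1 n2 b (ps @ ys @ ss)"
proof
    let ?xs = "ps @ ys @ ss"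
    fix e assume "e \<in> path_edges n1 n2 b ys"
    then obtain k where "e \<in> {2..n1 + n2}" "Suc k < length ys" "{ys ! k, ys ! Suc k} = {pa n1 b e, e}"
      by (auto simp: path_edges_def)
    then have "e \<in> {2..n1 + n2} \<and> Suc (length ps + k) < length ?xs
        \<and> {?xs ! (length ps + k), ?xs ! Suc (length ps + k)} = {pa n1 b e, e}"
      by (simp add: nth_append)
    then show "e \<in> path_edges n1 n2 b ?xs" unfolding path_edges_def by blast
qed

lemma path_edges_Cons:
  assumes "xs \<noteq> []"
  shows "path_edges n1 n2 b (x # xs) =
    path_edges n1 n2 b xs \<union> {e \<in> {2..n1 + n2}. {x, hd xs} = {pa n1 b e, e}}"
proof -
  have "(\<exists>k. Suc k < length (x # xs) \<and> {(x # xs) ! k, (x # xs) ! Suc k} = {pa n1 b e, e})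
     \<longleftrightarrow> {x, hd xs} = {pa n1 b e, e} \<or> (\<exists>k. Suc k < length xs \<and> {xs ! k, xs ! Suc k} = {pa n1 b e, e})"
    for e
  proof -
    have "(\<exists>k. R k) \<longleftrightarrow> R 0 \<or> (\<exists>k. R (Suc k))" for R :: "nat \<Rightarrow> bool"
      by (metis not0_implies_Suc)
    from this[of "\<lambda>k. Suc k < length (x # xs) \<and> {(x # xs) ! k, (x # xs) ! Suc k} = {pa n1 b e, e}"]
    show ?thesis using assms by (simp add: hd_conv_nth)
  qed
  then show ?thesis by (auto simp: path_edges_def)
qed

lemma path_edges_append:
  assumes "xs \<noteq> []" "ys \<noteq> []"
  shows "path_edges n1 n2 b (xs @ ys) = path_edges n1 n2 b xs \<union> path_edges n1 n2 b ys
    \<union> {e \<in> {2..n1 + n2}. {last xs, hd ys} = {pa n1 b e, e}}"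
  using assms(1)
proof (induction xs)
  case (Cons x xs)
  show ?case
  proof (cases "xs = []")
    case True
    moreover have "path_edges n1 n2 b [x] = {}" by (simp add: path_edges_def)
    ultimately show ?thesis using assms(2) by (simp add: path_edges_Cons)
  next
    case False
    then show ?thesis using Cons by (auto simp: path_edges_Cons)
  qed
qed simp

text \<open>
  An edge of a concatenated path lies inside one of the pieces or joins two successive pieces.
\<close>

lemma path_edges_concat:
  assumes "[] \<notin> set yss" "e \<in> path_edges n1 n2 b (concat yss)"
  shows "(\<exists>ys\<in>set yss. e \<in> path_edges n1 n2 b ys)
     \<or> (\<exists>j. Suc j < length yss \<and> {last (yss ! j), hd (yss ! Suc j)} = {pa n1 b e, e})"
  using assms
proof (induction yss)
  case Nil
  then show ?case by (simp add: path_edges_def)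
next
  case (Cons ys yss)
  show ?case
  proof (cases yss)
    case Nil
    then show ?thesis using Cons by simp
  next
    case (Cons zs zss)
    have ne: "ys \<noteq> []" "concat yss \<noteq> []" and hd: "hd (concat yss) = hd zs"
      using Cons.prems(1) by (auto simp: Cons hd_append)
    consider "e \<in> path_edges n1 n2 b ys" | "e \<in> path_edges n1 n2 b (concat yss)"
      | "{last ys, hd zs} = {pa n1 b e, e}"
      using Cons.prems(2) hd by (auto simp: path_edges_append[OF ne])
    then show ?thesis
    proof cases
      case 2
      then have "(\<exists>ys\<in>set yss. e \<in> path_edges n1 n2 b ys)
        \<or> (\<exists>j. Suc j < length yss \<and> {last (yss ! j), hd (yss ! Suc j)} = {pa n1 b e, e})"
        using Cons.IH Cons.prems(1) by auto
      then show ?thesis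
      proof
        assume "\<exists>j. Suc j < length yss \<and> {last (yss ! j), hd (yss ! Suc j)} = {pa n1 b e, e}"
        then obtain j where "Suc j < length yss" "{last (yss ! j), hd (yss ! Suc j)} = {pa n1 b e, e}"
          by blast
        then show ?thesis by (intro disjI2 exI[of _ "Suc j"]) simp
      qed auto
    next
      case 3
      then show ?thesis by (intro disjI2 exI[of _ 0]) (simp add: Cons)
    qed auto
  qed
qed

locale branched_path =
  fixes n1 n2 b :: nat
  assumes b_ge_1: "1 \<le> b" and b_less: "b < n1" and n2_ge_1: "1 \<le> n2"
begin

abbreviation "n \<equiv> n1 + n2"
abbreviation "par \<equiv> pa n1 b"
abbreviation "edges_of \<equiv> path_edges n1 n2 b"
abbreviation "tpath \<equiv> is_path n1 n2 b"

lemma adj_iff: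
  "adj n1 n2 b u v \<longleftrightarrow> v \<in> {2..n} \<and> u = par v \<or> u \<in> {2..n} \<and> v = par u"
  unfolding adj_def doubleton_eq_iff by blast

lemma par_less: "i \<in> {2..n} \<Longrightarrow> par i < i" and par_ge_1: "i \<in> {2..n} \<Longrightarrow> 1 \<le> par i"
  using b_ge_1 b_less by (auto simp: pa_def)

lemma par_in: "i \<in> {2..n} \<Longrightarrow> par i \<in> {1..n}"
  using par_less[of i] par_ge_1[of i] by auto

text \<open>
  The branching vertex is the only one with two children; this is where a path can turn.
\<close>

lemma same_parent:
  assumes "u \<in> {2..n}" "v \<in> {2..n}" "u \<noteq> v" "par u = par v"
  shows "par u = b" "{u, v} = {b + 1, n1 + 1}"
  using assms by (auto simp: pa_def split: if_splits)

text \<open>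
  In a rooted tree a path cannot climb again once it has descended, because the parent of the vertex
  just reached is the vertex it came from.
\<close>

lemma path_turning_point:
  assumes "tpath xs"
  obtains q where "q < length xs"
    "\<And>k. k < q \<Longrightarrow> xs ! k \<in> {2..n} \<and> xs ! Suc k = par (xs ! k)"
    "\<And>k. q \<le> k \<Longrightarrow> Suc k < length xs \<Longrightarrow> xs ! Suc k \<in> {2..n} \<and> xs ! k = par (xs ! Suc k)"
proof -
  define up where "up k \<longleftrightarrow> xs ! k \<in> {2..n} \<and> xs ! Suc k = par (xs ! k)" for k
  define down where "down k \<longleftrightarrow> xs ! Suc k \<in> {2..n} \<and> xs ! k = par (xs ! Suc k)" for k
  have dist: "distinct xs" and ne: "xs \<noteq> []" and succ: "successively (adj n1 n2 b) xs"
    using assms by (auto simp: is_path_def)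
  have step: "up k \<or> down k" if "Suc k < length xs" for k
  proof -
    have "adj n1 n2 b (xs ! k) (xs ! Suc k)" using succ that by (simp add: successively_nth)
    then show ?thesis unfolding adj_iff up_def down_def by blast
  qed
  define q where "q = (LEAST q. \<not> (Suc q < length xs \<and> up q))"
  have notup: "\<not> (Suc q < length xs \<and> up q)"
    unfolding q_def by (rule LeastI[of _ "length xs"]) simp
  have below: "Suc k < length xs \<and> up k" if "k < q" for k
    using not_less_Least[OF that[unfolded q_def]] by blast
  have "q < length xs"
    using below[of "q - 1"] ne by (cases q) auto
  moreover have "down k" if "q \<le> k" "Suc k < length xs" for k
    using that
  proof (induction k rule: dec_induct)
    case base
    then show ?case using step notup by blast
  next
    case (step k)
    have "down k" using step by simp
    moreover have "xs ! k \<noteq> xs ! Suc (Suc k)"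
      using dist step.prems by (simp add: nth_eq_iff_index_eq)
    ultimately have "\<not> up (Suc k)" unfolding up_def down_def by metis
    then show ?case using \<open>\<And>k. Suc k < length xs \<Longrightarrow> up k \<or> down k\<close>[OF step.prems] by blast
  qed
  moreover have "xs ! k \<in> {2..n} \<and> xs ! Suc k = par (xs ! k)" if "k < q" for k
    using below[OF that] by (simp only: up_def)
  ultimately show thesis by (intro that[of q]) (simp_all only: down_def)
qed

end

section \<open>Orthogonal projections onto column spans\<close>

definition proj_residual :: "nat \<Rightarrow> (nat \<Rightarrow> nat \<Rightarrow> real) \<Rightarrow> (nat \<Rightarrow> real) \<Rightarrow> nat \<Rightarrow> real" where
  "proj_residual n P x i = x i - mat_vec n P x i"

lemma mat_vec_diff: "mat_vec n P (\<lambda>i. x i - y i) = (\<lambda>i. mat_vec n P x i - mat_vec n P y i)"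
  by (simp add: mat_vec_def fun_eq_iff right_diff_distrib sum_subtractf)

lemma orth_proj_in: "is_orth_proj n V P \<Longrightarrow> mat_vec n P v \<in> V"
  by (simp add: is_orth_proj_def)

lemma orth_proj_orthogonal:
  "is_orth_proj n V P \<Longrightarrow> u \<in> V \<Longrightarrow> (\<Sum>i\<in>{1..n}. (v i - mat_vec n P v i) * u i) = 0"
  by (simp add: is_orth_proj_def)

lemma orth_proj_outside: "is_orth_proj n V P \<Longrightarrow> i \<notin> {1..n} \<or> k \<notin> {1..n} \<Longrightarrow> P i k = 0"
  by (simp add: is_orth_proj_def)

lemma col_spanI: "(\<lambda>i. \<Sum>j\<in>J. c j * M i j) \<in> col_span M J"
  unfolding col_span_def by (intro CollectI exI, rule refl)

lemma col_span_lincomb: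
  assumes "u \<in> col_span M J" "v \<in> col_span M J"
  shows "(\<lambda>i. u i + a * v i) \<in> col_span M J"
proof -
  obtain c c' where "u = (\<lambda>i. \<Sum>j\<in>J. c j * M i j)" "v = (\<lambda>i. \<Sum>j\<in>J. c' j * M i j)"
    using assms by (auto simp: col_span_def)
  then have "(\<lambda>i. u i + a * v i) = (\<lambda>i. \<Sum>j\<in>J. (c j + a * c' j) * M i j)"
    by (simp add: fun_eq_iff sum.distrib sum_distrib_left distrib_right mult.assoc)
  then show ?thesis unfolding col_span_def by (intro CollectI exI)
qed

lemma col_span_diff:
  assumes "u \<in> col_span M J" "v \<in> col_span M J"
  shows "(\<lambda>i. u i - v i) \<in> col_span M J"
  using col_span_lincomb[OF assms, of "- 1"] by simp

lemma col_in_col_span: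
  assumes "finite J" "j \<in> J"
  shows "(\<lambda>i. M i j) \<in> col_span M J"
proof -
  have "(\<Sum>k\<in>J. (if k = j then 1 else 0) * M i k) = M i j" for i
  proof -
    have "(\<Sum>k\<in>J. (if k = j then 1 else 0) * M i k) = (\<Sum>k\<in>J. if k = j then M i k else 0)"
      by (intro sum.cong) auto
    then show ?thesis using assms by simp
  qed
  then have "(\<lambda>i. M i j) = (\<lambda>i. \<Sum>k\<in>J. (if k = j then 1 else 0) * M i k)" by simp
  then show ?thesis unfolding col_span_def by (intro CollectI exI)
qed

lemma col_span_insert:
  assumes "finite J" "j \<notin> J"
  shows "v \<in> col_span M (insert j J) \<longleftrightarrow> (\<exists>u\<in>col_span M J. \<exists>a. v = (\<lambda>i. a * M i j + u i))"
proof
  assume "v \<in> col_span M (insert j J)"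
  then obtain c where "v = (\<lambda>i. \<Sum>k\<in>insert j J. c k * M i k)" by (auto simp: col_span_def)
  then have "v = (\<lambda>i. c j * M i j + (\<Sum>k\<in>J. c k * M i k))" using assms by simp
  then show "\<exists>u\<in>col_span M J. \<exists>a. v = (\<lambda>i. a * M i j + u i)" using col_spanI by (intro bexI exI)
next
  assume "\<exists>u\<in>col_span M J. \<exists>a. v = (\<lambda>i. a * M i j + u i)"
  then obtain c a where v: "v = (\<lambda>i. a * M i j + (\<Sum>k\<in>J. c k * M i k))" by (auto simp: col_span_def)
  have "(\<Sum>k\<in>J. c k * M i k) = (\<Sum>k\<in>J. (c(j := a)) k * M i k)" for i
    using assms by (intro sum.cong) auto
  then have "v = (\<lambda>i. \<Sum>k\<in>insert j J. (c(j := a)) k * M i k)"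
    using assms by (simp add: v)
  then show "v \<in> col_span M (insert j J)" unfolding col_span_def by (intro CollectI exI)
qed

text \<open>
  Gram-Schmidt: a further column enlarges the span by its residual \<open>z\<close>, and the rank-one matrix
  \<open>z z' / |z|\<^sup>2\<close> is added to the projection. Symmetry is carried along, since the weights multiply
  the projection matrix from the left. If \<open>z = 0\<close>, the division by zero adds nothing, as it should.
\<close>

lemma orth_proj_exists:
  fixes M :: "nat \<Rightarrow> nat \<Rightarrow> real"
  assumes supp: "\<And>i j. i \<notin> {1..n} \<Longrightarrow> M i j = 0" and "finite J"
  shows "\<exists>P. is_orth_proj n (col_span M J) P \<and> (\<forall>i k. P i k = P k i)"
  using \<open>finite J\<close>
proof induction
  case empty
  have "col_span M {} = {\<lambda>i. 0}" by (auto simp: col_span_def)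
  then have "is_orth_proj n (col_span M {}) (\<lambda>i k. 0)"
    by (simp add: is_orth_proj_def mat_vec_def)
  then show ?case by (intro exI[of _ "\<lambda>i k. 0"]) simp
next
  case (insert j J)
  then obtain P where P: "is_orth_proj n (col_span M J) P" and sym: "\<And>i k. P i k = P k i" by blast
  have P0: "P i k = 0" if "i \<notin> {1..n} \<or> k \<notin> {1..n}" for i k
    by (rule orth_proj_outside[OF P that])
  have PV: "mat_vec n P v \<in> col_span M J" for v
    by (rule orth_proj_in[OF P])
  have Porth: "(\<Sum>i\<in>{1..n}. (v i - mat_vec n P v i) * u i) = 0" if "u \<in> col_span M J" for u v
    by (rule orth_proj_orthogonal[OF P that])
  define m where "m = mat_vec n P (\<lambda>i. M i j)"
  define z where "z i = M i j - m i" for i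
  define N where "N = (\<Sum>i\<in>{1..n}. z i * z i)"
  have mV: "m \<in> col_span M J" unfolding m_def by (rule PV)
  have z_supp: "z i = 0" if "i \<notin> {1..n}" for i
    using P0 supp that by (simp add: z_def m_def mat_vec_def)
  have z_orth: "(\<Sum>i\<in>{1..n}. z i * u i) = 0" if "u \<in> col_span M J" for u
    using Porth[OF that, of "\<lambda>i. M i j"] by (simp only: z_def m_def)
  have span: "v \<in> col_span M (insert j J) \<longleftrightarrow> (\<exists>u\<in>col_span M J. \<exists>a. v = (\<lambda>i. a * z i + u i))" for v
  proof
    assume "v \<in> col_span M (insert j J)"
    then obtain u a where u: "u \<in> col_span M J" and v: "v = (\<lambda>i. a * M i j + u i)"
      using col_span_insert[OF insert.hyps] by blast
    have "v = (\<lambda>i. a * z i + (u i + a * m i))"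
      by (simp add: v z_def algebra_simps)
    then show "\<exists>u\<in>col_span M J. \<exists>a. v = (\<lambda>i. a * z i + u i)"
      using col_span_lincomb[OF u mV, of a] by (intro bexI exI)
  next
    assume "\<exists>u\<in>col_span M J. \<exists>a. v = (\<lambda>i. a * z i + u i)"
    then obtain u a where u: "u \<in> col_span M J" and v: "v = (\<lambda>i. a * z i + u i)" by blast
    have "v = (\<lambda>i. a * M i j + (u i + (- a) * m i))"
      by (simp add: v z_def algebra_simps)
    then show "v \<in> col_span M (insert j J)"
      unfolding col_span_insert[OF insert.hyps]
      using col_span_lincomb[OF u mV, of "- a"] by (intro bexI exI)
  qed
  define P' where "P' i k = P i k + z i * z k / N" for i k
  have mv: "mat_vec n P' v i = (\<Sum>k\<in>{1..n}. z k * v k) / N * z i + mat_vec n P v i" for v i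
  proof -
    have "mat_vec n P' v i = (\<Sum>k\<in>{1..n}. P i k * v k + (z i / N) * (z k * v k))"
      unfolding mat_vec_def P'_def by (intro sum.cong refl) (simp add: algebra_simps)
    also have "\<dots> = mat_vec n P v i + (z i / N) * (\<Sum>k\<in>{1..n}. z k * v k)"
      by (simp add: sum.distrib sum_distrib_left mat_vec_def)
    finally show ?thesis by simp
  qed
  have "is_orth_proj n (col_span M (insert j J)) P'"
    unfolding is_orth_proj_def
  proof (intro conjI allI impI ballI)
    fix i k assume "i \<notin> {1..n} \<or> k \<notin> {1..n}"
    then show "P' i k = 0" using P0 z_supp by (auto simp: P'_def)
  next
    fix v
    have "mat_vec n P' v = (\<lambda>i. ((\<Sum>k\<in>{1..n}. z k * v k) / N) * z i + mat_vec n P v i)"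
      by (simp add: mv fun_eq_iff)
    then show "mat_vec n P' v \<in> col_span M (insert j J)"
      unfolding span using PV[of v] by (intro bexI exI)
  next
    fix v x assume "x \<in> col_span M (insert j J)"
    then obtain u a where u: "u \<in> col_span M J" and x: "x = (\<lambda>i. a * z i + u i)" using span by blast
    define s where "s = (\<Sum>k\<in>{1..n}. z k * v k)"
    have zz: "s - s / N * N = 0"
    proof (cases "N = 0")
      case True
      then have "\<forall>i\<in>{1..n}. z i * z i = 0" unfolding N_def by (subst (asm) sum_nonneg_eq_0_iff) auto
      then show ?thesis by (simp add: s_def)
    qed simp
    have vz: "(\<Sum>i\<in>{1..n}. (v i - mat_vec n P v i) * z i) = s"
    proof -
      have "(\<Sum>i\<in>{1..n}. (v i - mat_vec n P v i) * z i)
          = (\<Sum>i\<in>{1..n}. z i * v i) - (\<Sum>i\<in>{1..n}. z i * mat_vec n P v i)"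
        unfolding sum_subtractf[symmetric] by (intro sum.cong refl) (simp add: algebra_simps)
      then show ?thesis using z_orth[OF PV[of v]] by (simp add: s_def)
    qed
    have "(\<Sum>i\<in>{1..n}. (v i - mat_vec n P' v i) * x i)
        = (\<Sum>i\<in>{1..n}. a * ((v i - mat_vec n P v i) * z i) - a * (s / N) * (z i * z i)
            + (v i - mat_vec n P v i) * u i - s / N * (z i * u i))"
      unfolding mv x s_def[symmetric] by (intro sum.cong refl) (simp add: algebra_simps)
    also have "\<dots> = a * s - a * (s / N) * N + 0 - s / N * 0"
      by (simp only: sum.distrib sum_subtractf sum_distrib_left[symmetric] vz Porth[OF u] z_orth[OF u] N_def)
    also have "\<dots> = a * (s - s / N * N)" by (simp add: algebra_simps)
    finally show "(\<Sum>i\<in>{1..n}. (v i - mat_vec n P' v i) * x i) = 0"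
      by (simp only: zz mult_zero_right)
  qed
  moreover have "\<forall>i k. P' i k = P' k i"
  proof (intro allI)
    show "P' i k = P' k i" for i k unfolding P'_def by (subst sym) (simp only: mult.commute)
  qed
  ultimately show ?case by blast
qed

lemma orth_proj_unique:
  assumes "is_orth_proj n (col_span M J) P" "is_orth_proj n (col_span M J) P'"
  shows "P = P'"
proof (intro ext)
  fix i k
  show "P i k = P' i k"
  proof (cases "i \<in> {1..n} \<and> k \<in> {1..n}")
    case False
    then have "P i k = 0" "P' i k = 0" using assms by (auto intro: orth_proj_outside)
    then show ?thesis by simp
  next
    case True
    define v :: "nat \<Rightarrow> real" where "v j = (if j = k then 1 else 0)" for j
    define u where "u = (\<lambda>i. mat_vec n P v i - mat_vec n P' v i)"
    have u: "u \<in> col_span M J"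
      unfolding u_def by (intro col_span_diff orth_proj_in assms)
    have "(\<Sum>i\<in>{1..n}. (v i - mat_vec n P v i) * u i) = 0"
      "(\<Sum>i\<in>{1..n}. (v i - mat_vec n P' v i) * u i) = 0"
      by (rule orth_proj_orthogonal[OF assms(1) u], rule orth_proj_orthogonal[OF assms(2) u])
    then have "(\<Sum>i\<in>{1..n}. (v i - mat_vec n P' v i) * u i - (v i - mat_vec n P v i) * u i) = 0"
      by (simp only: sum_subtractf)
    also have "(\<Sum>i\<in>{1..n}. (v i - mat_vec n P' v i) * u i - (v i - mat_vec n P v i) * u i)
      = (\<Sum>i\<in>{1..n}. u i * u i)"
      by (intro sum.cong refl) (simp add: u_def algebra_simps)
    finally have "u i * u i = 0" using True by (subst (asm) sum_nonneg_eq_0_iff) auto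
    moreover have "mat_vec n Q v i = Q i k" for Q
    proof -
      have "mat_vec n Q v i = (\<Sum>j\<in>{1..n}. if j = k then Q i j else 0)"
        unfolding mat_vec_def v_def by (intro sum.cong) auto
      then show ?thesis using True by simp
    qed
    ultimately show ?thesis by (simp add: u_def)
  qed
qed

lemma orth_proj_facts:
  assumes "\<And>i j. i \<notin> {1..n} \<Longrightarrow> M i j = 0" and "finite J"
  shows "is_orth_proj n (col_span M J) (orth_proj n (col_span M J))"
    and "orth_proj n (col_span M J) i k = orth_proj n (col_span M J) k i"
proof -
  obtain P where P: "is_orth_proj n (col_span M J) P" "\<And>i k. P i k = P k i"
    using orth_proj_exists[where M = M, OF assms] by blast
  have eq: "orth_proj n (col_span M J) = P"
    unfolding orth_proj_def
    by (rule the_equality[where P = "is_orth_proj n (col_span M J)", OF P(1) orth_proj_unique[OF _ P(1)]])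
  show "is_orth_proj n (col_span M J) (orth_proj n (col_span M J))"
    unfolding eq by (rule P(1))
  show "orth_proj n (col_span M J) i k = orth_proj n (col_span M J) k i"
    unfolding eq by (rule P(2))
qed

lemma proj_residual_le:
  assumes P: "is_orth_proj n V P"
  shows "L2_set (proj_residual n P x) {1..n} \<le> L2_set x {1..n}"
proof -
  have orth: "(\<Sum>i\<in>{1..n}. proj_residual n P x i * mat_vec n P x i) = 0"
    unfolding proj_residual_def by (rule orth_proj_orthogonal[OF P orth_proj_in[OF P]])
  have "(\<Sum>i\<in>{1..n}. (x i)\<^sup>2) = (\<Sum>i\<in>{1..n}. (proj_residual n P x i)\<^sup>2
      + 2 * (proj_residual n P x i * mat_vec n P x i) + (mat_vec n P x i)\<^sup>2)"
    by (intro sum.cong refl) (simp add: proj_residual_def power2_eq_square algebra_simps)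
  also have "\<dots> = (\<Sum>i\<in>{1..n}. (proj_residual n P x i)\<^sup>2) + (\<Sum>i\<in>{1..n}. (mat_vec n P x i)\<^sup>2)"
    by (simp only: sum.distrib sum_distrib_left[symmetric] orth)
  finally show ?thesis unfolding L2_set_def by (simp add: sum_nonneg)
qed

lemma proj_residual_subspace:
  assumes P: "is_orth_proj n (col_span M J) P" and v: "v \<in> col_span M J" and "i \<in> {1..n}"
  shows "proj_residual n P v i = 0"
proof -
  have "(\<Sum>i\<in>{1..n}. (v i - mat_vec n P v i) * (v i - mat_vec n P v i)) = 0"
    by (rule orth_proj_orthogonal[OF P col_span_diff[OF v orth_proj_in[OF P]]])
  then have "\<forall>i\<in>{1..n}. (v i - mat_vec n P v i) * (v i - mat_vec n P v i) = 0"
    by (subst (asm) sum_nonneg_eq_0_iff) auto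
  then show ?thesis using assms(3) by (simp add: proj_residual_def)
qed

text \<open>
  The norm of the residual is the distance from the subspace; it is 1-Lipschitz, and translations by
  elements of the subspace do not change it.
\<close>

lemma proj_residual_lipschitz:
  assumes P: "is_orth_proj n (col_span M J) P" and v: "v \<in> col_span M J"
  shows "L2_set (proj_residual n P x) {1..n}
    \<le> L2_set (proj_residual n P y) {1..n} + L2_set (\<lambda>i. x i - y i - v i) {1..n}"
proof -
  have "L2_set (proj_residual n P x) {1..n}
      = L2_set (\<lambda>i. proj_residual n P y i + proj_residual n P (\<lambda>i. x i - y i - v i) i) {1..n}"
  proof (rule L2_set_cong[OF refl])
    fix i assume "i \<in> {1..n}"
    then have "v i = mat_vec n P v i"
      using proj_residual_subspace[OF P v] by (simp add: proj_residual_def)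
    then show "proj_residual n P x i
        = proj_residual n P y i + proj_residual n P (\<lambda>i. x i - y i - v i) i"
      unfolding proj_residual_def mat_vec_diff by linarith
  qed
  also have "\<dots> \<le> L2_set (proj_residual n P y) {1..n}
      + L2_set (proj_residual n P (\<lambda>i. x i - y i - v i)) {1..n}"
    by (rule L2_set_triangle_ineq)
  also have "\<dots> \<le> L2_set (proj_residual n P y) {1..n} + L2_set (\<lambda>i. x i - y i - v i) {1..n}"
    using proj_residual_le[OF P] by (intro add_left_mono)
  finally show ?thesis .
qed

section \<open>The path matrix\<close>

context branched_path
begin

text \<open>
  \<open>below j i\<close> means that \<open>j\<close> lies on the path from the root to \<open>i\<close>: up to \<open>b\<close> every vertex with a
  smaller number is an ancestor, and beyond \<open>b\<close> both vertices have to belong to the same branch.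
\<close>

definition below :: "nat \<Rightarrow> nat \<Rightarrow> bool" where
  "below j i \<longleftrightarrow> j \<le> i \<and> (j \<le> b \<or> i \<le> n1 \<or> n1 < j)"

lemma below_self: "below i i"
  by (auto simp: below_def)

lemma below_step: "i \<in> {2..n} \<Longrightarrow> below j i \<longleftrightarrow> j = i \<or> below j (par i)"
  using b_less b_ge_1 by (auto simp: below_def pa_def)

lemma below_root: "1 \<le> j \<Longrightarrow> below j 1 \<longleftrightarrow> j = 1"
  using b_ge_1 by (auto simp: below_def)

lemma root_path_set:
  assumes "tpath xs" "hd xs = 1"
  shows "set xs = {j \<in> {1..n}. below j (last xs)}"
  using assms
proof (induction xs rule: rev_induct)
  case Nil
  then show ?case by (simp add: is_path_def)
next
  case (snoc x xs)
  have x: "x \<in> {1..n}" "x \<notin> set xs" using snoc.prems(1) by (auto simp: is_path_def)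
  show ?case
  proof (cases "xs = []")
    case True
    then have "x = 1" using snoc.prems(2) by simp
    have "{j \<in> {1..n}. below j 1} = {1}" using x(1) \<open>x = 1\<close> below_root below_self by fastforce
    then show ?thesis using True \<open>x = 1\<close> by simp
  next
    case False
    have "tpath xs" using snoc.prems(1) False by (auto simp: is_path_def successively_append_iff)
    then have IH: "set xs = {j \<in> {1..n}. below j (last xs)}" using snoc.IH snoc.prems(2) False by simp
    have "adj n1 n2 b (last xs) x"
      using snoc.prems(1) False by (auto simp: is_path_def successively_append_iff)
    then consider "x \<in> {2..n}" "last xs = par x" | "last xs \<in> {2..n}" "x = par (last xs)"
      unfolding adj_iff by blast
    then show ?thesis
    proof cases
      case 1
      have "{j \<in> {1..n}. below j x} = insert x {j \<in> {1..n}. below j (par x)}"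
        using below_step[OF 1(1)] x(1) by blast
      then show ?thesis using IH 1(2) by simp
    next
      case 2
      have "below x (last xs)" using below_step[OF 2(1), of x] below_self[of x] 2(2) by blast
      then have "x \<in> set xs" using x(1) unfolding IH by blast
      then show ?thesis using x(2) by blast
    qed
  qed
qed

lemma root_path_exists: "i \<in> {1..n} \<Longrightarrow> \<exists>xs. tpath xs \<and> hd xs = 1 \<and> last xs = i"
proof (induction i rule: less_induct)
  case (less i)
  show ?case
  proof (cases "i = 1")
    case True
    then show ?thesis using less.prems by (intro exI[of _ "[1]"]) (simp add: is_path_def)
  next
    case False
    then have i: "i \<in> {2..n}" using less.prems by auto
    obtain xs where xs: "tpath xs" "hd xs = 1" "last xs = par i"
      using less.IH[OF par_less[OF i] par_in[OF i]] by blast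
    have "adj n1 n2 b (par i) i" using i by (auto simp: adj_def)
    moreover have "i \<notin> set xs"
      using root_path_set[OF xs(1,2)] xs(3) par_less[OF i] by (simp add: below_def)
    moreover have "xs \<noteq> []" using xs(1) by (simp add: is_path_def)
    ultimately have "tpath (xs @ [i])" "hd (xs @ [i]) = 1" "last (xs @ [i]) = i"
      using xs less.prems by (auto simp: is_path_def successively_append_iff)
    then show ?thesis by (intro exI[of _ "xs @ [i]"] conjI)
  qed
qed

abbreviation "X \<equiv> path_mat n1 n2 b"

lemma path_mat_eq:
  assumes "i \<in> {1..n}" "j \<in> {1..n}"
  shows "X i j = (if below j i then 1 else 0)"
proof -
  have "(\<exists>xs. tpath xs \<and> hd xs = 1 \<and> last xs = i \<and> j \<in> set xs) \<longleftrightarrow> below j i"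
    (is "?L \<longleftrightarrow> _")
  proof
    assume ?L
    then obtain xs where "tpath xs" "hd xs = 1" "last xs = i" "j \<in> set xs" by (elim exE conjE)
    then show "below j i" using root_path_set[of xs] by simp
  next
    assume "below j i"
    moreover obtain xs where "tpath xs" "hd xs = 1" "last xs = i"
      using root_path_exists[OF assms(1)] by blast
    moreover from this have "set xs = {j \<in> {1..n}. below j i}" using root_path_set by simp
    ultimately show ?L using assms(2) by (intro exI[of _ xs]) simp
  qed
  then show ?thesis by (simp only: path_mat_def)
qed

lemma path_mat_outside:
  assumes "i \<notin> {1..n}"
  shows "X i j = 0"
proof -
  have "\<not> (\<exists>xs. tpath xs \<and> hd xs = 1 \<and> last xs = i \<and> j \<in> set xs)"
  proof (intro notI, elim exE conjE)
    fix xs assume "tpath xs" "last xs = i"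
    then have "i \<in> set xs" "set xs \<subseteq> {1..n}" by (auto simp: is_path_def)
    then show False using assms by blast
  qed
  then show ?thesis by (simp only: path_mat_def if_False)
qed

text \<open>
  The columns of the path matrix are the indicators of the subtrees, so its coefficients are the
  increments along the edges.
\<close>

lemma path_mat_increment:
  assumes "i \<in> {2..n}"
  shows "mat_vec n X \<beta> i - mat_vec n X \<beta> (par i) = \<beta> i"
proof -
  have "mat_vec n X \<beta> i - mat_vec n X \<beta> (par i) = (\<Sum>k\<in>{1..n}. if k = i then \<beta> k else 0)"
    unfolding mat_vec_def sum_subtractf[symmetric]
  proof (rule sum.cong[OF refl])
    fix k assume k: "k \<in> {1..n}"
    have i: "i \<in> {1..n}" using assms by simp
    have "\<not> below i (par i)" using par_less[OF assms] by (simp add: below_def)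
    then show "X i k * \<beta> k - X (par i) k * \<beta> k = (if k = i then \<beta> k else 0)"
      unfolding path_mat_eq[OF i k] path_mat_eq[OF par_in[OF assms] k] below_step[OF assms, of k]
      by auto
  qed
  then show ?thesis using assms by simp
qed

lemma path_mat_root: "mat_vec n X \<beta> 1 = \<beta> 1"
proof -
  have one: "1 \<in> {1..n}" using n2_ge_1 by simp
  have "mat_vec n X \<beta> 1 = (\<Sum>k\<in>{1..n}. if k = 1 then \<beta> k else 0)"
    unfolding mat_vec_def
  proof (rule sum.cong[OF refl])
    fix k assume k: "k \<in> {1..n}"
    have "1 \<le> k" using k by (simp only: atLeastAtMost_iff)
    show "X 1 k * \<beta> k = (if k = 1 then \<beta> k else 0)"
      unfolding path_mat_eq[OF one k] below_root[OF \<open>1 \<le> k\<close>]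
      by (simp only: if_distrib[of "\<lambda>x. x * _"] mult_1 mult_zero_left)
  qed
  then show ?thesis using one by simp
qed

end

section \<open>The weights\<close>

context branched_path
begin

lemma below_parent: "x \<in> {2..n} \<Longrightarrow> below x i \<Longrightarrow> below (par x) i"
  unfolding below_def pa_def using b_less b_ge_1 by (simp split: if_splits) linarith

lemma below_single_child:
  assumes "x \<in> {2..n}" "par x \<noteq> b" "below (par x) i"
  shows "i = par x \<or> below x i"
  using assms unfolding below_def pa_def by (simp split: if_splits) linarith

lemma below_branch_children:
  "below b i \<longleftrightarrow> i = b \<or> below (b + 1) i \<or> below (n1 + 1) i"
  "\<not> (below (b + 1) i \<and> below (n1 + 1) i)"
  using b_less unfolding below_def by linarith+

text \<open>
  A path that starts in \<open>v\<close>, climbs to the branching vertex and descends to its other child \<open>c\<close>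
  splits the subtree of \<open>b\<close> into the subtrees of \<open>v\<close> and of \<open>c\<close> and the \<open>q\<close> vertices \<open>xs ! 1, \<dots>, xs ! q\<close>
  climbed through.
\<close>

lemma turning_chain:
  assumes xs: "tpath xs" and q: "1 \<le> q" "Suc q < length xs"
    and up: "\<And>k. k < q \<Longrightarrow> xs ! k \<in> {2..n} \<and> xs ! Suc k = par (xs ! k)"
    and down: "xs ! Suc q \<in> {2..n}" "xs ! q = par (xs ! Suc q)"
  shows "xs ! q = b"
    and "below (xs ! Suc q) i \<Longrightarrow> below b i \<and> \<not> below (xs ! 0) i"
    and "below (xs ! 0) i \<Longrightarrow> below b i"
    and "below b i \<Longrightarrow> \<not> below (xs ! Suc q) i \<Longrightarrow> \<not> below (xs ! 0) i \<Longrightarrow> i \<in> (!) xs ` {1..q}"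
proof -
  have dist: "distinct xs" using xs by (simp add: is_path_def)
  define p where "p = xs ! (q - 1)"
  have p: "p \<in> {2..n}" "xs ! q = par p"
    using up[of "q - 1"] q by (simp_all add: p_def)
  have "p \<noteq> xs ! Suc q" unfolding p_def using dist q by (subst nth_eq_iff_index_eq) auto
  then have b: "par p = b" and pc: "{p, xs ! Suc q} = {b + 1, n1 + 1}"
    using same_parent[OF p(1) down(1)] p(2) down(2) by simp_all
  show qb: "xs ! q = b" using p b by simp
  have children: "below b i \<longleftrightarrow> i = b \<or> below p i \<or> below (xs ! Suc q) i"
      "\<not> (below p i \<and> below (xs ! Suc q) i)" for i
    using pc below_branch_children[of i] unfolding doubleton_eq_iff by metis+
  have climb: "below (xs ! 0) i \<Longrightarrow> below (xs ! k) i" if "k < q" for k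
    using that by (induction k) (use up below_parent in force)+
  then have v_p: "below (xs ! 0) i \<Longrightarrow> below p i" using q by (simp add: p_def)
  show "below (xs ! Suc q) i \<Longrightarrow> below b i \<and> \<not> below (xs ! 0) i"
    using children[of i] v_p by blast
  show "below (xs ! 0) i \<Longrightarrow> below b i" using children[of i] v_p by blast
  have descend: "below (xs ! 0) i \<or> i \<in> (!) xs ` {1..k}" if "k < q" "below (xs ! k) i" for k
    using that
  proof (induction k)
    case (Suc k)
    have "xs ! Suc k \<noteq> xs ! q" using dist q Suc.prems by (subst nth_eq_iff_index_eq) auto
    then have "par (xs ! k) \<noteq> b" using up[of k] Suc.prems qb by simp
    then have "i = xs ! Suc k \<or> below (xs ! k) i"
      using below_single_child[of "xs ! k" i] up[of k] Suc.prems by simp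
    then show ?case
    proof
      assume "below (xs ! k) i"
      then have "below (xs ! 0) i \<or> i \<in> (!) xs ` {1..k}" using Suc by simp
      moreover have "(!) xs ` {1..k} \<subseteq> (!) xs ` {1..Suc k}" by (intro image_mono) auto
      ultimately show ?thesis by blast
    qed auto
  qed simp
  assume a: "below b i" "\<not> below (xs ! Suc q) i" "\<not> below (xs ! 0) i"
  then consider "i = xs ! q" | "below p i" using children(1)[of i] qb by blast
  then show "i \<in> (!) xs ` {1..q}"
  proof cases
    case 1
    then show ?thesis using q by simp
  next
    case 2
    then have "i \<in> (!) xs ` {1..q - 1}" using descend[of "q - 1"] q a(3) by (simp add: p_def)
    moreover have "(!) xs ` {1..q - 1} \<subseteq> (!) xs ` {1..q}" by (intro image_mono) auto
    ultimately show ?thesis by blast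
  qed
qed

end

locale weighted_branched_path = branched_path +
  fixes S :: "nat set" and \<gamma> :: real
  assumes S_edges: "S \<subseteq> {2..n}" and gamma_gt_1: "\<gamma> > 1"
begin

abbreviation "w \<equiv> weight n1 n2 b S \<gamma>"
abbreviation "V \<equiv> col_span X ({1} \<union> S)"
abbreviation "om \<equiv> omega n1 n2 b S"

lemma finite_S: "finite S"
  using S_edges finite_subset by blast

lemma n_pos: "0 < real n"
  using n2_ge_1 by simp

lemma proj: "is_orth_proj n V (orth_proj n V)"
  and proj_sym: "orth_proj n V i k = orth_proj n V k i"
  using orth_proj_facts[where M = X and n = n and J = "{1} \<union> S"] path_mat_outside finite_S
  by simp_all

lemma omega_eq:
  "om j = L2_set (proj_residual n (orth_proj n V) (\<lambda>i. X i j)) {1..n} / sqrt (real n)"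
proof -
  have "L2_set (\<lambda>k. \<Sum>i\<in>{1..n}. X i j * ((if i = k then 1 else 0) - orth_proj n V i k)) {1..n}
    = L2_set (proj_residual n (orth_proj n V) (\<lambda>i. X i j)) {1..n}"
  proof (rule L2_set_cong[OF refl])
    fix k assume k: "k \<in> {1..n}"
    define Q where "Q = orth_proj n V"
    have Q: "Q i k = Q k i" for i unfolding Q_def by (rule proj_sym)
    have "(\<Sum>i\<in>{1..n}. X i j * ((if i = k then 1 else 0) - Q i k))
        = (\<Sum>i\<in>{1..n}. (if i = k then X i j else 0) - Q k i * X i j)"
      by (intro sum.cong refl) (simp add: Q right_diff_distrib)
    also have "\<dots> = proj_residual n Q (\<lambda>i. X i j) k"
      using k by (simp add: sum_subtractf proj_residual_def mat_vec_def)
    finally show "(\<Sum>i\<in>{1..n}. X i j * ((if i = k then 1 else 0) - orth_proj n V i k))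
        = proj_residual n (orth_proj n V) (\<lambda>i. X i j) k" by (simp only: Q_def)
  qed
  then show ?thesis by (simp only: omega_def Let_def)
qed

lemma omega_S:
  assumes "j \<in> S"
  shows "om j = 0"
proof -
  have "(\<lambda>i. X i j) \<in> V" using finite_S assms by (intro col_in_col_span) auto
  then have "L2_set (proj_residual n (orth_proj n V) (\<lambda>i. X i j)) {1..n} = L2_set (\<lambda>i. 0) {1..n}"
    by (intro L2_set_cong refl proj_residual_subspace[OF proj])
  also have "\<dots> = 0" by (simp add: L2_set_def)
  finally show ?thesis unfolding omega_eq by (simp only: div_0)
qed

lemma omega_le_1:
  assumes "j \<in> {1..n}"
  shows "om j \<le> 1"
proof -
  have "L2_set (proj_residual n (orth_proj n V) (\<lambda>i. X i j)) {1..n} \<le> L2_set (\<lambda>i. X i j) {1..n}"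
    by (rule proj_residual_le[OF proj])
  also have "\<dots> \<le> L2_set (\<lambda>i. 1) {1..n}"
    by (intro L2_set_mono) (simp_all add: path_mat_def)
  also have "\<dots> = sqrt (real n)" by (simp add: L2_set_def)
  finally show ?thesis unfolding omega_eq using n_pos by (simp add: divide_le_eq)
qed

lemma weight_S: "j \<in> S \<Longrightarrow> w j = 1"
  by (simp add: weight_def omega_S)

lemma weight_nonneg:
  assumes "j \<in> {1..n}"
  shows "0 \<le> w j"
proof -
  have "om j \<le> \<gamma>" using omega_le_1[OF assms] gamma_gt_1 by linarith
  then show ?thesis using gamma_gt_1 by (simp add: weight_def)
qed

text \<open>
  The drop that \<^const>\<open>skip_profile\<close> has to compensate is small compared with the number \<open>q\<close> of climbing
  steps. The column of \<open>v \<in> S\<close> belongs to the span, so the distances of the columns of \<open>b\<close> and \<open>c\<close> from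
  the span differ by at most the norm of the difference of these columns, corrected by the column of
  \<open>v\<close>. That is the indicator of the \<open>q\<close> vertices climbed through.
\<close>

lemma weight_drop_at_branching:
  assumes xs: "tpath xs" and q: "1 \<le> q" "Suc q < length xs" and S: "xs ! 0 \<in> S"
    and up: "\<And>k. k < q \<Longrightarrow> xs ! k \<in> {2..n} \<and> xs ! Suc k = par (xs ! k)"
    and down: "xs ! Suc q \<in> {2..n}" "xs ! q = par (xs ! Suc q)"
  shows "max 0 (w (xs ! q) - w (xs ! Suc q)) / sqrt (real q) \<le> 1 / sqrt (real n)"
proof -
  define c v where "c = xs ! Suc q" and "v = xs ! 0"
  note chain = turning_chain[OF xs q up down]
  define A where "A = (!) xs ` {1..q}"
  have finA: "finite A" and cardA: "card A \<le> q"
    using card_image_le[of "{1..q}" "(!) xs"] by (auto simp: A_def)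
  have in_n: "b \<in> {1..n}" "c \<in> {1..n}" "v \<in> {1..n}"
    using b_ge_1 b_less down(1) S S_edges by (auto simp: c_def v_def)
  \<comment> \<open>the element of the span to translate by is the negative of the column of \<open>v\<close>\<close>
  have "(\<lambda>i. X i v) \<in> V" using finite_S S unfolding v_def by (intro col_in_col_span) auto
  then have mem: "(\<lambda>i. X i v + (- 2) * X i v) \<in> V" by (intro col_span_lincomb)
  have ptw: "(X i c - X i b - (X i v + (- 2) * X i v))\<^sup>2 \<le> (if i \<in> A then 1 else 0)"
    if "i \<in> {1..n}" for i
  proof -
    consider "below c i" "below b i" "\<not> below v i" | "\<not> below c i" "below v i" "below b i"
      | "\<not> below c i" "\<not> below v i" "\<not> below b i"
      | "\<not> below c i" "\<not> below v i" "below b i" "i \<in> A"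
      using chain(2-4)[of i] unfolding c_def v_def A_def by blast
    then show ?thesis
      using that in_n by cases (simp_all add: path_mat_eq)
  qed
  have "(\<Sum>i\<in>{1..n}. (X i c - X i b - (X i v + (- 2) * X i v))\<^sup>2) \<le> (\<Sum>i\<in>{1..n}. if i \<in> A then 1 else 0)"
    by (intro sum_mono ptw)
  also have "\<dots> = real (card ({1..n} \<inter> A))" by (simp add: sum.If_cases)
  also have "\<dots> \<le> real (card A)" using finA by (intro of_nat_mono card_mono) auto
  also have "\<dots> \<le> real q" using cardA by simp
  finally have "L2_set (\<lambda>i. X i c - X i b - (X i v + (- 2) * X i v)) {1..n} \<le> sqrt (real q)"
    unfolding L2_set_def by (rule real_sqrt_le_mono)
  then have "L2_set (proj_residual n (orth_proj n V) (\<lambda>i. X i c)) {1..n}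
      \<le> L2_set (proj_residual n (orth_proj n V) (\<lambda>i. X i b)) {1..n} + sqrt (real q)"
    using proj_residual_lipschitz[OF proj mem, of "\<lambda>i. X i c" "\<lambda>i. X i b"] by linarith
  then have "om c \<le> om b + sqrt (real q) / sqrt (real n)"
    unfolding omega_eq add_divide_distrib[symmetric] by (rule divide_right_mono) simp
  then have "(om c - om b) / \<gamma> \<le> (sqrt (real q) / sqrt (real n)) / \<gamma>"
    using gamma_gt_1 by (intro divide_right_mono) auto
  also have "\<dots> \<le> (sqrt (real q) / sqrt (real n)) / 1"
    using gamma_gt_1 by (intro divide_left_mono) auto
  finally have "w b - w c \<le> sqrt (real q) / sqrt (real n)"
    by (simp add: weight_def diff_divide_distrib)
  then have "max 0 (w b - w c) \<le> sqrt (real q) / sqrt (real n)" by simp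
  then have "max 0 (w b - w c) / sqrt (real q) \<le> (sqrt (real q) / sqrt (real n)) / sqrt (real q)"
    by (rule divide_right_mono) simp
  then show ?thesis using q chain(1) by (simp add: c_def)
qed

end

section \<open>Rays\<close>

context branched_path
begin

lemma edge_unique:
  assumes "e \<in> {2..n}" "e' \<in> {2..n}" "{par e, e} = {par e', e'}"
  shows "e = e'"
  using assms(3) par_less[OF assms(1)] par_less[OF assms(2)] unfolding doubleton_eq_iff by auto

end

context weighted_branched_path
begin

text \<open>
  A ray is a path \<open>v # ys\<close> whose first edge belongs to \<open>S\<close>. The squared increments of \<open>w\<close> that it
  consumes belong to edges whose parent is a vertex of \<open>ys\<close>: all edges inside \<open>ys\<close>, and the first edge
  exactly if the ray starts towards the root. Since an edge has one parent, rays with disjoint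
  vertices never consume the same increment.
\<close>

definition ray_energy :: "nat \<Rightarrow> nat list \<Rightarrow> real" where
  "ray_energy v ys = (\<Sum>e\<in>{e \<in> edges_of (v # ys). par e \<in> set ys}. (w e - w (par e))\<^sup>2)"

definition ray_excess :: "nat \<Rightarrow> nat list \<Rightarrow> real" where
  "ray_excess v ys = (if b \<in> set ys then 2 * sqrt (ray_energy v ys) / sqrt (real n) else 0)"

lemma finite_edges_of: "finite (edges_of xs)"
  by (simp add: path_edges_def)

lemma ray_energy_nonneg: "0 \<le> ray_energy v ys"
  by (simp add: ray_energy_def sum_nonneg)

text \<open>
  Edges carry the weight of their lower endpoint. If the ray only descends, or only climbs, the weights
  of successive edges differ by the increment of \<open>w\<close> across an edge, and the weights themselves can
  serve in \<open>end_value_bound\<close>. If it turns, it does so at \<open>b\<close>, and the edge weights are the vertex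
  weights with that of \<open>b\<close> skipped; then \<^const>\<open>skip_profile\<close> takes over.
\<close>

lemma ray_bound:
  assumes path: "tpath (v # ys)" and ne: "ys \<noteq> []" and e: "e \<in> S" "{v, hd ys} = {par e, e}"
  shows "\<bar>f (hd ys)\<bar> \<le> (\<Sum>e\<in>edges_of ys. w e * \<bar>f e - f (par e)\<bar>)
     + sqrt (1 / real (length ys) + ray_energy v ys + ray_excess v ys) * sqrt (\<Sum>i\<in>set ys. (f i)\<^sup>2)"
proof -
  define xs where "xs = v # ys"
  define M where "M = length ys - 1"
  have len: "length ys = Suc M" "length xs = Suc (Suc M)" using ne by (auto simp: M_def xs_def)
  have path_xs: "tpath xs" and dist: "distinct xs" using path by (auto simp: xs_def is_path_def)
  have xs_Suc: "xs ! Suc k = ys ! k" for k by (simp add: xs_def)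
  obtain q where q: "q < length xs"
    and up: "\<And>k. k < q \<Longrightarrow> xs ! k \<in> {2..n} \<and> xs ! Suc k = par (xs ! k)"
    and down: "\<And>k. q \<le> k \<Longrightarrow> Suc k < length xs \<Longrightarrow> xs ! Suc k \<in> {2..n} \<and> xs ! k = par (xs ! Suc k)"
    using path_turning_point[OF path_xs] by blast
  \<comment> \<open>the lower endpoint of the edge between \<open>xs ! k\<close> and \<open>xs ! Suc k\<close> has position \<open>idx k\<close>\<close>
  define idx where "idx k = (if k < q then k else Suc k)" for k
  define lab where "lab k = xs ! idx k" for k
  have idx_less: "idx k < length xs" if "k \<le> M" for k
    using that by (simp add: idx_def len)
  have lab_up: "lab k \<in> {2..n} \<and> lab k = xs ! k \<and> par (lab k) = xs ! Suc k" if "k < q" for k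
    using up[OF that] that by (simp add: lab_def idx_def)
  have lab_down: "lab k \<in> {2..n} \<and> lab k = xs ! Suc k \<and> par (lab k) = xs ! k" if "q \<le> k" "k \<le> M" for k
    using down[of k] that by (simp add: lab_def idx_def len)
  have lab: "lab k \<in> {2..n}" "{xs ! k, xs ! Suc k} = {par (lab k), lab k}" if "k \<le> M" for k
  proof -
    consider "k < q" | "q \<le> k" by linarith
    then show "lab k \<in> {2..n}" using lab_up[of k] lab_down[of k] that by cases blast+
    consider "k < q" | "q \<le> k" by linarith
    then show "{xs ! k, xs ! Suc k} = {par (lab k), lab k}"
      using lab_up[of k] lab_down[of k] that by cases (metis insert_commute)+
  qed
  have inj: "inj_on lab {..M}"
  proof (rule inj_onI)
    fix k k' assume k: "k \<in> {..M}" "k' \<in> {..M}" "lab k = lab k'"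
    then have "idx k = idx k'"
      using dist idx_less unfolding lab_def by (simp add: nth_eq_iff_index_eq)
    then show "k = k'" by (simp add: idx_def split: if_splits)
  qed
  have lab_xs: "lab k \<in> edges_of xs" if "k \<le> M" for k
    unfolding path_edges_def using lab[OF that] that len by (intro CollectI conjI exI[of _ k]) simp_all
  have lab_ys: "lab (Suc k) \<in> edges_of ys" if "k < M" for k
    unfolding path_edges_def using lab[of "Suc k"] that len
    by (intro CollectI conjI exI[of _ k]) (simp_all add: xs_Suc)
  have "lab 0 = e"
  proof (rule edge_unique)
    show "{par (lab 0), lab 0} = {par e, e}"
      using lab(2)[of 0] e(2) ne by (simp add: xs_def hd_conv_nth)
  qed (use lab(1)[of 0] e(1) S_edges in auto)
  then have w0: "w (lab 0) = 1" using e(1) weight_S by simp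
  have energy: "(\<Sum>k\<in>I. (w (xs ! k) - w (xs ! Suc k))\<^sup>2) \<le> ray_energy v ys"
    if I: "I \<subseteq> {..M}" "\<And>k. k \<in> I \<Longrightarrow> par (lab k) \<in> set ys" for I
  proof -
    have "(\<Sum>k\<in>I. (w (xs ! k) - w (xs ! Suc k))\<^sup>2) = (\<Sum>k\<in>I. (w (lab k) - w (par (lab k)))\<^sup>2)"
    proof (rule sum.cong[OF refl])
      fix k assume "k \<in> I"
      then have "k \<le> M" using I(1) by auto
      then show "(w (xs ! k) - w (xs ! Suc k))\<^sup>2 = (w (lab k) - w (par (lab k)))\<^sup>2"
        using lab(2) unfolding doubleton_eq_iff by (metis power2_commute)
    qed
    also have "\<dots> = (\<Sum>e\<in>lab ` I. (w e - w (par e))\<^sup>2)"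
      using inj_on_subset[OF inj I(1)] by (simp add: sum.reindex)
    also have "\<dots> \<le> ray_energy v ys"
      unfolding ray_energy_def xs_def[symmetric] using I lab_xs finite_edges_of
      by (intro sum_mono2) auto
    finally show ?thesis .
  qed
  have in_ys: "xs ! k \<in> set ys" if "1 \<le> k" "k \<le> Suc M" for k
    using that len xs_Suc[of "k - 1"] by simp
  have par_lab: "par (lab k) \<in> set ys" if "k \<le> M" "k < q \<or> 1 \<le> k" for k
  proof (cases "k < q")
    case True
    then have "par (lab k) = xs ! Suc k" using lab_up by blast
    then show ?thesis using in_ys[of "Suc k"] that by simp
  next
    case False
    then have "par (lab k) = xs ! k" using lab_down[OF leI[OF False] that(1)] by blast
    then show ?thesis using in_ys[of k] that False by simp
  qed
  define a where "a k = w (xs ! k)" for k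
  define turns where "turns \<longleftrightarrow> 1 \<le> q \<and> q \<le> M"
  define c where "c = (if turns then skip_profile a q else (\<lambda>k. w (lab k)))"
  have c0: "c 0 = 1"
    using w0 lab_up[of 0] by (auto simp: c_def turns_def skip_profile_def a_def)
  have c_le: "c k \<le> w (lab k)" if "k \<le> M" for k
  proof (cases turns)
    case True
    have "0 \<le> max 0 (a q - a (Suc q)) * (real k / real q)" by simp
    then show ?thesis using True lab_up[of k] lab_down[of k] that
      by (auto simp: c_def skip_profile_def a_def)
  qed (simp add: c_def)
  have c_energy: "(\<Sum>k<M. (c k - c (Suc k))\<^sup>2) \<le> ray_energy v ys + ray_excess v ys"
  proof -
    have excess: "0 \<le> ray_excess v ys" by (simp add: ray_excess_def ray_energy_nonneg)
    consider "turns" | "q = 0" | "q = Suc M" using q len unfolding turns_def by linarith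
    then show ?thesis
    proof cases
      case 1
      then have q1: "1 \<le> q" "q \<le> M" by (auto simp: turns_def)
      define T where "T = (\<Sum>k\<le>M. (a k - a (Suc k))\<^sup>2)"
      have T: "T \<le> ray_energy v ys"
        unfolding T_def a_def
      proof (rule energy)
        fix k assume "k \<in> {..M}"
        then show "par (lab k) \<in> set ys" using q1 by (intro par_lab) auto
      qed simp
      have down_q: "xs ! Suc q \<in> {2..n}" "xs ! q = par (xs ! Suc q)" using down[of q] q1 len by auto
      have "xs ! 0 \<in> S" using lab_up[of 0] q1 \<open>lab 0 = e\<close> e(1) by simp
      then have y: "max 0 (a q - a (Suc q)) / sqrt (real q) \<le> 1 / sqrt (real n)"
        unfolding a_def using weight_drop_at_branching[OF path_xs q1(1) _ _ up down_q] q1 len by simp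
      have "b \<in> set ys"
        using turning_chain(1)[OF path_xs q1(1) _ up down_q] q1 len in_ys[of q] by simp
      then have ex: "ray_excess v ys = 2 * (1 / sqrt (real n)) * sqrt (ray_energy v ys)"
        by (simp add: ray_excess_def)
      have "(\<Sum>k<M. (c k - c (Suc k))\<^sup>2) \<le> T + 2 * (max 0 (a q - a (Suc q)) / sqrt (real q)) * sqrt T"
        using skip_profile_energy[OF q1, of a] 1 by (simp add: c_def T_def)
      also have "2 * (max 0 (a q - a (Suc q)) / sqrt (real q)) * sqrt T
          \<le> 2 * (1 / sqrt (real n)) * sqrt (ray_energy v ys)"
        using y T by (intro mult_mono) (auto simp: T_def sum_nonneg)
      finally show ?thesis using T ex by linarith
    next
      case 2
      have "(\<Sum>k<M. (c k - c (Suc k))\<^sup>2) = (\<Sum>k<M. (w (xs ! Suc k) - w (xs ! Suc (Suc k)))\<^sup>2)"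
        using lab_down 2 by (intro sum.cong refl) (simp add: c_def turns_def)
      also have "\<dots> = (\<Sum>k\<in>{1..M}. (w (xs ! k) - w (xs ! Suc k))\<^sup>2)"
        by (rule sum.reindex_bij_witness[of _ "\<lambda>k. k - 1" Suc]) auto
      also have "\<dots> \<le> ray_energy v ys"
        by (intro energy par_lab) auto
      finally show ?thesis using excess by linarith
    next
      case 3
      have "(\<Sum>k<M. (c k - c (Suc k))\<^sup>2) = (\<Sum>k<M. (w (xs ! k) - w (xs ! Suc k))\<^sup>2)"
        using lab_up 3 by (intro sum.cong refl) (simp add: c_def turns_def)
      also have "\<dots> \<le> ray_energy v ys"
        using 3 by (intro energy par_lab) auto
      finally show ?thesis using excess by linarith
    qed
  qed
  have w_nonneg: "0 \<le> w (lab k)" if "k \<le> M" for k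
    using lab(1)[OF that] by (intro weight_nonneg) auto
  define g where "g k = f (ys ! k)" for k
  have "\<bar>g 0\<bar> \<le> (\<Sum>k<M. w (lab (Suc k)) * \<bar>g (Suc k) - g k\<bar>)
      + sqrt (1 / real (Suc M) + (\<Sum>k<M. (c k - c (Suc k))\<^sup>2)) * sqrt (\<Sum>k\<le>M. (g k)\<^sup>2)"
    by (rule end_value_bound[where c = c and e = "\<lambda>k. w (lab k)", OF c0 c_le w_nonneg])
  also have "g 0 = f (hd ys)" using ne by (simp add: g_def hd_conv_nth)
  also have "(\<Sum>k<M. w (lab (Suc k)) * \<bar>g (Suc k) - g k\<bar>)
      \<le> (\<Sum>e\<in>edges_of ys. w e * \<bar>f e - f (par e)\<bar>)"
  proof -
    have "(\<Sum>k<M. w (lab (Suc k)) * \<bar>g (Suc k) - g k\<bar>)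
        = (\<Sum>k<M. w (lab (Suc k)) * \<bar>f (lab (Suc k)) - f (par (lab (Suc k)))\<bar>)"
    proof (rule sum.cong[OF refl])
      fix k assume "k \<in> {..<M}"
      then have "{ys ! k, ys ! Suc k} = {par (lab (Suc k)), lab (Suc k)}"
        using lab(2)[of "Suc k"] by (simp add: xs_Suc)
      then have "\<bar>g (Suc k) - g k\<bar> = \<bar>f (lab (Suc k)) - f (par (lab (Suc k)))\<bar>"
        unfolding doubleton_eq_iff g_def by (metis abs_minus_commute)
      then show "w (lab (Suc k)) * \<bar>g (Suc k) - g k\<bar>
          = w (lab (Suc k)) * \<bar>f (lab (Suc k)) - f (par (lab (Suc k)))\<bar>" by simp
    qed
    also have "\<dots> = (\<Sum>e\<in>(\<lambda>k. lab (Suc k)) ` {..<M}. w e * \<bar>f e - f (par e)\<bar>)"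
    proof -
      have "inj_on (\<lambda>k. lab (Suc k)) {..<M}"
        using inj_onD[OF inj] by (intro inj_onI) fastforce
      then show ?thesis by (simp add: sum.reindex)
    qed
    also have "\<dots> \<le> (\<Sum>e\<in>edges_of ys. w e * \<bar>f e - f (par e)\<bar>)"
    proof (rule sum_mono2[OF finite_edges_of])
      show "(\<lambda>k. lab (Suc k)) ` {..<M} \<subseteq> edges_of ys" using lab_ys by auto
      fix e assume "e \<in> edges_of ys - (\<lambda>k. lab (Suc k)) ` {..<M}"
      then show "0 \<le> w e * \<bar>f e - f (par e)\<bar>"
        by (intro mult_nonneg_nonneg weight_nonneg) (auto simp: path_edges_def)
    qed
    finally show ?thesis .
  qed
  also have "sqrt (1 / real (Suc M) + (\<Sum>k<M. (c k - c (Suc k))\<^sup>2)) * sqrt (\<Sum>k\<le>M. (g k)\<^sup>2)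
      \<le> sqrt (1 / real (length ys) + ray_energy v ys + ray_excess v ys) * sqrt (\<Sum>i\<in>set ys. (f i)\<^sup>2)"
  proof -
    have "(\<Sum>k\<le>M. (g k)\<^sup>2) = (\<Sum>i\<in>(!) ys ` {..M}. (f i)\<^sup>2)"
      using dist len by (subst sum.reindex) (auto simp: g_def xs_def inj_on_def nth_eq_iff_index_eq)
    also have "(!) ys ` {..M} = set ys"
      by (auto simp: set_conv_nth len less_Suc_eq_le)
    finally show ?thesis
      using c_energy by (intro mult_mono) (auto simp: len sum_nonneg ray_energy_nonneg ray_excess_def)
  qed
  finally show ?thesis by simp
qed

end

section \<open>Summing over disjoint rays\<close>

lemma sum_disjoint_le:
  fixes g :: "'b \<Rightarrow> real"
  assumes "finite R" "\<And>r. r \<in> R \<Longrightarrow> finite (A r)" "disjoint_family_on A R" "\<And>r. r \<in> R \<Longrightarrow> A r \<subseteq> B"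
    "finite B" "\<And>x. x \<in> B \<Longrightarrow> 0 \<le> g x"
  shows "(\<Sum>r\<in>R. sum g (A r)) \<le> sum g B"
proof -
  have "(\<Sum>r\<in>R. sum g (A r)) = sum g (\<Union>r\<in>R. A r)"
    using assms(1-3) by (subst sum.UNION_disjoint) (auto simp: disjoint_family_on_def)
  also have "\<dots> \<le> sum g B" using assms by (intro sum_mono2) auto
  finally show ?thesis .
qed

context branched_path
begin

lemma edges_of_endpoints: "e \<in> edges_of xs \<Longrightarrow> e \<in> {2..n} \<and> e \<in> set xs \<and> par e \<in> set xs"
proof -
  assume "e \<in> edges_of xs"
  then obtain k where e: "e \<in> {2..n}" "Suc k < length xs" "{xs ! k, xs ! Suc k} = {par e, e}"
    unfolding path_edges_def by blast
  have "{xs ! k, xs ! Suc k} \<subseteq> set xs" using e(2) by simp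
  then have "{par e, e} \<subseteq> set xs" by (simp only: e(3))
  then show ?thesis using e(1) by simp
qed

lemma inc_mat_apply:
  assumes "i \<in> {2..n}"
  shows "mat_vec n (inc_mat n1 b) w i = w i - w (par i)"
proof -
  have "mat_vec n (inc_mat n1 b) w i
      = (\<Sum>k\<in>{1..n}. (if k = i then w k else 0) - (if k = par i then w k else 0))"
    unfolding mat_vec_def inc_mat_def by (intro sum.cong refl) simp
  also have "\<dots> = w i - w (par i)"
    using assms par_in[OF assms] by (simp add: sum_subtractf)
  finally show ?thesis .
qed

lemma zero_rows_apply:
  "mat_vec n (zero_rows C M) w i = (if i \<in> C then 0 else mat_vec n M w i)"
  by (simp add: mat_vec_def zero_rows_def)

lemma Dstar_norm_sq:
  "(L2_set (mat_vec n (zero_rows C (inc_mat n1 b)) w) {2..n})\<^sup>2 = (\<Sum>e\<in>{2..n} - C. (w e - w (par e))\<^sup>2)"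
proof -
  have "(L2_set (mat_vec n (zero_rows C (inc_mat n1 b)) w) {2..n})\<^sup>2
      = (\<Sum>e\<in>{2..n}. if e \<in> C then 0 else (w e - w (par e))\<^sup>2)"
    unfolding L2_set_def
    by (subst real_sqrt_pow2) (auto intro!: sum.cong sum_nonneg simp: zero_rows_apply inc_mat_apply)
  also have "\<dots> = (\<Sum>e\<in>{2..n} - C. (w e - w (par e))\<^sup>2)"
    by (intro sum.mono_neutral_cong_right) auto
  finally show ?thesis .
qed

end

context weighted_branched_path
begin

text \<open>
  Every edge of \<open>S\<close> is left by one ray in each direction, and \<open>|f j - f (par j)| \<le> |f j| + |f (par j)|\<close>.
  Adding the ray bounds, the Cauchy-Schwarz inequality leaves the norm of \<open>f\<close> times the root of the
  total energy. As \<open>b\<close> lies on at most one ray, the excess is charged once, with at most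
  \<open>2 * D / sqrt n\<close>. A ray has at most \<open>n\<close> vertices, so \<open>1 / n \<le> K\<close>, and the excess is covered by the
  cross term of \<open>(sqrt K + D)\<^sup>2\<close>.
\<close>

lemma ray_family_bound:
  fixes v :: "'r \<Rightarrow> nat" and ys :: "'r \<Rightarrow> nat list" and f :: "nat \<Rightarrow> real"
  assumes finR: "finite R" and Sne: "S \<noteq> {}"
    and path: "\<And>r. r \<in> R \<Longrightarrow> tpath (v r # ys r)" and ne: "\<And>r. r \<in> R \<Longrightarrow> ys r \<noteq> []"
    and head: "\<And>r. r \<in> R \<Longrightarrow> \<exists>e\<in>S. {v r, hd (ys r)} = {par e, e}"
    and inner: "\<And>r. r \<in> R \<Longrightarrow> edges_of (ys r) \<inter> S = {}"
    and conn: "\<And>r. r \<in> R \<Longrightarrow> edges_of (v r # ys r) \<inter> C = {}"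
    and disj: "disjoint_family_on (\<lambda>r. set (ys r)) R"
    and covered: "\<And>e. e \<in> S \<Longrightarrow> (\<exists>r\<in>R. v r = par e \<and> hd (ys r) = e) \<and> (\<exists>r\<in>R. v r = e \<and> hd (ys r) = par e)"
  defines "K \<equiv> \<Sum>r\<in>R. 1 / real (length (ys r))"
    and "D \<equiv> L2_set (mat_vec n (zero_rows C (inc_mat n1 b)) w) {2..n}"
  shows "(\<Sum>j\<in>S. \<bar>w j * (f j - f (par j))\<bar>) - (\<Sum>j\<in>{2..n} - S. \<bar>w j * (f j - f (par j))\<bar>)
    \<le> (sqrt K + D) * sqrt (\<Sum>i\<in>{1..n}. (f i)\<^sup>2)"
proof -
  have D0: "0 \<le> D" by (simp add: D_def)
  have ys_in: "set (ys r) \<subseteq> {1..n}" if "r \<in> R" for r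
    using path[OF that] by (simp add: is_path_def)
  have Sedges: "(\<Sum>j\<in>S. \<bar>w j * (f j - f (par j))\<bar>) \<le> (\<Sum>r\<in>R. \<bar>f (hd (ys r))\<bar>)"
  proof -
    obtain rd where rd: "\<And>e. e \<in> S \<Longrightarrow> rd e \<in> R \<and> v (rd e) = par e \<and> hd (ys (rd e)) = e"
      using covered by metis
    obtain ru where ru: "\<And>e. e \<in> S \<Longrightarrow> ru e \<in> R \<and> v (ru e) = e \<and> hd (ys (ru e)) = par e"
      using covered by metis
    have inj: "inj_on rd S" "inj_on ru S" using rd ru by (metis inj_onI)+
    have apart: "rd ` S \<inter> ru ` S = {}"
    proof (intro equals0I, elim IntE imageE)
      fix r e e' assume r: "r = rd e" "e \<in> S" "r = ru e'" "e' \<in> S"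
      then have "e' = par e" "e = par e'" using rd[of e] ru[of e'] by auto
      moreover have "par e < e" "par e' < e'" using r S_edges by (auto intro!: par_less)
      ultimately show False by linarith
    qed
    have "(\<Sum>j\<in>S. \<bar>w j * (f j - f (par j))\<bar>) \<le> (\<Sum>j\<in>S. \<bar>f (hd (ys (rd j)))\<bar> + \<bar>f (hd (ys (ru j)))\<bar>)"
      using rd ru by (intro sum_mono) (simp add: weight_S)
    also have "\<dots> = (\<Sum>r\<in>rd ` S. \<bar>f (hd (ys r))\<bar>) + (\<Sum>r\<in>ru ` S. \<bar>f (hd (ys r))\<bar>)"
      using inj by (simp add: sum.distrib sum.reindex)
    also have "\<dots> = (\<Sum>r\<in>rd ` S \<union> ru ` S. \<bar>f (hd (ys r))\<bar>)"
      using apart finite_S by (simp add: sum.union_disjoint)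
    also have "\<dots> \<le> (\<Sum>r\<in>R. \<bar>f (hd (ys r))\<bar>)"
      using rd ru finR by (intro sum_mono2) auto
    finally show ?thesis .
  qed
  define E where "E r = 1 / real (length (ys r)) + ray_energy (v r) (ys r) + ray_excess (v r) (ys r)" for r
  define F where "F r = (\<Sum>i\<in>set (ys r). (f i)\<^sup>2)" for r
  have E0: "0 \<le> E r" and F0: "0 \<le> F r" for r
    by (simp_all add: E_def F_def ray_excess_def ray_energy_nonneg sum_nonneg)
  have "(\<Sum>r\<in>R. \<bar>f (hd (ys r))\<bar>)
      \<le> (\<Sum>r\<in>R. (\<Sum>e\<in>edges_of (ys r). w e * \<bar>f e - f (par e)\<bar>) + sqrt (E r) * sqrt (F r))"
  proof (rule sum_mono)
    fix r assume r: "r \<in> R"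
    obtain e where "e \<in> S" "{v r, hd (ys r)} = {par e, e}" using head[OF r] by blast
    then show "\<bar>f (hd (ys r))\<bar> \<le> (\<Sum>e\<in>edges_of (ys r). w e * \<bar>f e - f (par e)\<bar>) + sqrt (E r) * sqrt (F r)"
      using ray_bound[OF path[OF r] ne[OF r], of e f] by (simp only: E_def F_def)
  qed
  also have "\<dots> = (\<Sum>r\<in>R. \<Sum>e\<in>edges_of (ys r). w e * \<bar>f e - f (par e)\<bar>) + (\<Sum>r\<in>R. sqrt (E r) * sqrt (F r))"
    by (rule sum.distrib)
  also have "(\<Sum>r\<in>R. \<Sum>e\<in>edges_of (ys r). w e * \<bar>f e - f (par e)\<bar>)
      \<le> (\<Sum>e\<in>{2..n} - S. w e * \<bar>f e - f (par e)\<bar>)"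
  proof (rule sum_disjoint_le[OF finR])
    show "disjoint_family_on (\<lambda>r. edges_of (ys r)) R"
      using disj edges_of_endpoints unfolding disjoint_family_on_def by blast
    show "edges_of (ys r) \<subseteq> {2..n} - S" if "r \<in> R" for r
      using inner[OF that] edges_of_endpoints by blast
    show "0 \<le> w e * \<bar>f e - f (par e)\<bar>" if "e \<in> {2..n} - S" for e
      using that by (intro mult_nonneg_nonneg weight_nonneg) auto
  qed (auto simp: finite_edges_of)
  also have "(\<Sum>e\<in>{2..n} - S. w e * \<bar>f e - f (par e)\<bar>) = (\<Sum>j\<in>{2..n} - S. \<bar>w j * (f j - f (par j))\<bar>)"
    by (intro sum.cong refl) (auto simp: abs_mult weight_nonneg)
  also have "(\<Sum>r\<in>R. sqrt (E r) * sqrt (F r)) \<le> sqrt (sum E R) * sqrt (sum F R)"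
  proof -
    have "(\<Sum>r\<in>R. sqrt (E r) * sqrt (F r))\<^sup>2 \<le> (\<Sum>r\<in>R. (sqrt (E r))\<^sup>2) * (\<Sum>r\<in>R. (sqrt (F r))\<^sup>2)"
      by (rule Cauchy_Schwarz_ineq_sum)
    then have "(\<Sum>r\<in>R. sqrt (E r) * sqrt (F r))\<^sup>2 \<le> sum E R * sum F R"
      using E0 F0 by simp
    then show ?thesis unfolding real_sqrt_mult[symmetric] by (rule real_le_rsqrt)
  qed
  also have "sqrt (sum E R) * sqrt (sum F R) \<le> (sqrt K + D) * sqrt (\<Sum>i\<in>{1..n}. (f i)\<^sup>2)"
  proof (intro mult_mono)
    show "sqrt (sum F R) \<le> sqrt (\<Sum>i\<in>{1..n}. (f i)\<^sup>2)"
      unfolding F_def using ys_in finR disj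
      by (intro real_sqrt_le_mono sum_disjoint_le) auto
    \<comment> \<open>the edges whose increments the ray \<open>r\<close> consumes\<close>
    define Bu where "Bu r = {e \<in> edges_of (v r # ys r). par e \<in> set (ys r)}" for r
    have energies: "(\<Sum>r\<in>R. ray_energy (v r) (ys r)) \<le> D\<^sup>2"
      unfolding D_def Dstar_norm_sq ray_energy_def Bu_def[symmetric]
    proof (rule sum_disjoint_le[OF finR])
      show "disjoint_family_on Bu R"
        using disj unfolding disjoint_family_on_def Bu_def by blast
      show "Bu r \<subseteq> {2..n} - C" if "r \<in> R" for r
        using conn[OF that] edges_of_endpoints unfolding Bu_def by blast
    qed (auto simp: Bu_def finite_edges_of)
    have energy_le: "sqrt (ray_energy (v r) (ys r)) \<le> D" if "r \<in> R" for r
    proof -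
      have "ray_energy (v r) (ys r) \<le> D\<^sup>2"
        using energies member_le_sum[OF that _ finR, of "\<lambda>r. ray_energy (v r) (ys r)"] ray_energy_nonneg
        by fastforce
      then show ?thesis using D0 by (intro real_le_lsqrt ray_energy_nonneg)
    qed
    have excesses: "(\<Sum>r\<in>R. ray_excess (v r) (ys r)) \<le> 2 * D / sqrt (real n)"
    proof -
      define T where "T = {r \<in> R. b \<in> set (ys r)}"
      have "r = r'" if "r \<in> T" "r' \<in> T" for r r'
        using that disj unfolding T_def disjoint_family_on_def by blast
      then have "card T \<le> 1" using finR by (auto simp: card_le_Suc0_iff_eq T_def)
      have "(\<Sum>r\<in>R. ray_excess (v r) (ys r)) = (\<Sum>r\<in>T. ray_excess (v r) (ys r))"
        using finR by (intro sum.mono_neutral_right) (auto simp: T_def ray_excess_def)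
      also have "\<dots> \<le> (\<Sum>r\<in>T. 2 * D / sqrt (real n))"
        using energy_le by (intro sum_mono) (auto simp: T_def ray_excess_def intro!: divide_right_mono)
      also have "\<dots> = real (card T) * (2 * D / sqrt (real n))" by simp
      also have "\<dots> \<le> 1 * (2 * D / sqrt (real n))"
        using \<open>card T \<le> 1\<close> D0 by (intro mult_right_mono) auto
      finally show ?thesis by simp
    qed
    have "1 / real n \<le> K"
    proof -
      obtain r where r: "r \<in> R" using Sne covered by blast
      have "card (set (ys r)) \<le> card {1..n}" using ys_in[OF r] by (intro card_mono) auto
      moreover have "distinct (ys r)" using path[OF r] by (simp add: is_path_def)
      ultimately have "length (ys r) \<le> n" by (simp add: distinct_card)
      then have "1 / real n \<le> 1 / real (length (ys r))"
        using ne[OF r] by (intro frac_le) auto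
      also have "\<dots> \<le> K" unfolding K_def using r finR by (intro member_le_sum) auto
      finally show ?thesis .
    qed
    then have rootK: "1 / sqrt (real n) \<le> sqrt K"
      using real_sqrt_le_mono by (fastforce simp: real_sqrt_divide)
    have K0: "0 \<le> K" by (simp add: K_def sum_nonneg)
    have "sum E R \<le> K + D\<^sup>2 + 2 * D / sqrt (real n)"
      unfolding E_def sum.distrib K_def[symmetric] using energies excesses by linarith
    also have "2 * D / sqrt (real n) = 2 * D * (1 / sqrt (real n))" by simp
    also have "\<dots> \<le> 2 * D * sqrt K" using rootK D0 by (intro mult_left_mono) auto
    finally have "sum E R \<le> (sqrt K + D)\<^sup>2" using K0 by (simp add: power2_sum mult_ac)
    then show "sqrt (sum E R) \<le> sqrt K + D" using D0 K0 E0 by (intro real_le_lsqrt) (auto simp: sum_nonneg)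
  qed (use D0 F0 in \<open>auto simp: K_def sum_nonneg\<close>)
  finally show ?thesis using Sedges by linarith
qed

end

section \<open>The rays of an admissible decomposition\<close>

lemma path_edges_rev: "path_edges n1 n2 b (rev xs) = path_edges n1 n2 b xs"
proof (induction xs)
  case (Cons x xs)
  show ?case
  proof (cases "xs = []")
    case False
    then show ?thesis
      using Cons by (simp add: path_edges_append path_edges_Cons last_rev insert_commute)
        (simp add: path_edges_def)
  qed simp
qed simp

lemma concat_around_junction:
  assumes "Suc j < length yss"
  obtains ps ss where "concat yss = ps @ (yss ! j @ yss ! Suc j) @ ss"
proof -
  have "yss = take j yss @ [yss ! j, yss ! Suc j] @ drop (Suc (Suc j)) yss"
    using assms by (simp add: Cons_nth_drop_Suc)
  then have "concat yss = concat (take j yss) @ (yss ! j @ yss ! Suc j) @ concat (drop (Suc (Suc j)) yss)"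
    by (metis append.assoc append.right_neutral concat.simps(1) concat.simps(2) concat_append)
  then show thesis by (rule that)
qed

lemma distinct_concat_disjoint:
  "distinct (concat yss) \<Longrightarrow> j < length yss \<Longrightarrow> k < length yss \<Longrightarrow> j \<noteq> k
    \<Longrightarrow> set (yss ! j) \<inter> set (yss ! k) = {}"
proof (induction yss arbitrary: j k)
  case (Cons zs yss)
  have apart: "set zs \<inter> set (yss ! i) = {}" if "i < length yss" for i
  proof -
    have "set (yss ! i) \<subseteq> \<Union> (set ` set yss)" using nth_mem[OF that] by blast
    moreover have "set zs \<inter> \<Union> (set ` set yss) = {}" using Cons.prems(1) by simp
    ultimately show ?thesis by blast
  qed
  show ?case
    using Cons apart by (cases j; cases k) (auto simp: Int_commute)
qed simp

context branched_path
begin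

text \<open>
  Two successive segments are joined by an edge of \<open>S\<close>. It starts two rays: one into the front part
  \<open>A\<close> of the later segment and one, in reverse direction, into the hind part \<open>B\<close> of the earlier one.
\<close>

lemma junction_rays:
  assumes path: "tpath xs" and seg: "is_segmentation n1 n2 b S xs yss" and j: "Suc j < length yss"
    and hind: "yss ! j = B' @ B" "B \<noteq> []" and front: "yss ! Suc j = A @ A'" "A \<noteq> []"
  shows "tpath (last (yss ! j) # A)" "edges_of (last (yss ! j) # A) \<subseteq> edges_of xs" "edges_of A \<inter> S = {}"
    and "tpath (hd (yss ! Suc j) # rev B)" "edges_of (hd (yss ! Suc j) # rev B) \<subseteq> edges_of xs"
      "edges_of (rev B) \<inter> S = {}"
proof -
  obtain ps ss where xs: "xs = ps @ (yss ! j @ yss ! Suc j) @ ss"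
    using concat_around_junction[OF j] seg unfolding is_segmentation_def by metis
  have "yss ! j = butlast (yss ! j) @ [last (yss ! j)]"
    using hind by (intro append_butlast_last_id[symmetric]) simp
  then have "xs = (ps @ butlast (yss ! j)) @ (last (yss ! j) # A) @ (A' @ ss)"
    unfolding xs front(1) by (metis append.assoc append_Cons append_Nil)
  then show "tpath (last (yss ! j) # A)" "edges_of (last (yss ! j) # A) \<subseteq> edges_of xs"
    using path is_path_sublist path_edges_sublist by (metis list.distinct(1), metis)
  have "yss ! Suc j = hd (yss ! Suc j) # tl (yss ! Suc j)" using front by simp
  then have xs': "xs = (ps @ B') @ (B @ [hd (yss ! Suc j)]) @ (tl (yss ! Suc j) @ ss)"
    unfolding xs hind(1) by (metis append.assoc append_Cons append_Nil)
  have rev: "hd (yss ! Suc j) # rev B = rev (B @ [hd (yss ! Suc j)])" by simp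
  have "tpath (B @ [hd (yss ! Suc j)])"
    by (rule is_path_sublist[OF path[unfolded xs']]) simp
  then show "tpath (hd (yss ! Suc j) # rev B)" unfolding rev is_path_rev .
  show "edges_of (hd (yss ! Suc j) # rev B) \<subseteq> edges_of xs"
    using path_edges_sublist[of n1 n2 b "B @ [hd (yss ! Suc j)]" "ps @ B'" "tl (yss ! Suc j) @ ss"]
    unfolding rev path_edges_rev xs'[symmetric] .
  have segs: "edges_of (yss ! j) \<inter> S = {}" "edges_of (yss ! Suc j) \<inter> S = {}"
    using seg j unfolding is_segmentation_def by (auto dest: nth_mem Suc_lessD)
  have "edges_of A \<subseteq> edges_of (yss ! Suc j)"
    using path_edges_sublist[of n1 n2 b A "[]" A'] by (simp add: front(1))
  then show "edges_of A \<inter> S = {}" using segs by blast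
  have "edges_of B \<subseteq> edges_of (yss ! j)"
    using path_edges_sublist[of n1 n2 b B B' "[]"] by (simp add: hind(1))
  then show "edges_of (rev B) \<inter> S = {}" unfolding path_edges_rev using segs by blast
qed

end

lemma sum_front_back:
  fixes s :: nat and \<alpha> \<beta> :: "nat \<Rightarrow> real"
  assumes "1 \<le> s"
  shows "(\<Sum>j\<in>{1..s}. (if j = s then x else \<alpha> (Suc j)) + (if j = 1 then y else \<beta> j))
    = y + (\<Sum>j\<in>{2..s}. \<alpha> j + \<beta> j) + x"
proof -
  have "(\<Sum>j\<in>{1..s}. if j = s then x else \<alpha> (Suc j)) = (\<Sum>j\<in>{1..<s}. \<alpha> (Suc j)) + x"
  proof -
    have "{1..s} = insert s {1..<s}" using assms by auto
    then show ?thesis by simp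
  qed
  moreover have "(\<Sum>j\<in>{1..<s}. \<alpha> (Suc j)) = (\<Sum>j\<in>{2..s}. \<alpha> j)"
    by (rule sum.reindex_bij_witness[of _ "\<lambda>j. j - 1" Suc]) auto
  moreover have "(\<Sum>j\<in>{1..s}. if j = 1 then y else \<beta> j) = y + (\<Sum>j\<in>{2..s}. \<beta> j)"
  proof -
    have "{1..s} = insert 1 {2..s}" using assms by auto
    then show ?thesis by simp
  qed
  ultimately show ?thesis by (simp add: sum.distrib)
qed

context weighted_branched_path
begin

text \<open>
  An inner segment, being entered by rays from both of its ends, is cut after \<open>u\<close> vertices; the first
  and the last segment of a path graph are covered by a single ray each. The reciprocal lengths of
  these rays are exactly the summands of \<^const>\<open>K_branch\<close>.
\<close>

lemma admissible_bound:
  fixes P :: "nat \<Rightarrow> nat list" and d u :: "nat \<Rightarrow> nat \<Rightarrow> nat" and f :: "nat \<Rightarrow> real"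
  defines "s \<equiv> (\<lambda>i. card (S_part n1 n2 b S i))" and "C \<equiv> connecting_edges n1 n2 b P"
  assumes adm: "admissible_decomposition n1 n2 b S P d"
    and u: "\<forall>i\<in>{1,2,3}. \<forall>j\<in>{2..s i}. 2 \<le> u i j \<and> u i j + 2 \<le> d i j"
  shows "(\<Sum>j\<in>S. \<bar>w j * (f j - f (par j))\<bar>) - (\<Sum>j\<in>{2..n} - S. \<bar>w j * (f j - f (par j))\<bar>)
    \<le> (sqrt (K_branch s d u) + L2_set (mat_vec n (zero_rows C (inc_mat n1 b)) w) {2..n})
        * sqrt (\<Sum>i\<in>{1..n}. (f i)\<^sup>2)"
proof -
  define I :: "nat set" where "I = {1, 2, 3}"
  have pathP: "tpath (P i)" if "i \<in> I" for i
    using adm that unfolding admissible_decomposition_def I_def by blast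
  have disjP: "disjoint_family_on (\<lambda>i. set (P i)) I" and CS: "C \<inter> S = {}"
    using adm unfolding admissible_decomposition_def I_def C_def by blast+
  have s1: "1 \<le> s i" if "i \<in> I" for i
    using adm that unfolding admissible_decomposition_def I_def s_def Let_def by blast
  have "\<forall>i\<in>I. \<exists>yss. is_segmentation n1 n2 b S (P i) yss \<and> length yss = s i + 1
      \<and> (\<forall>j\<in>{1..s i + 1}. d i j = length (yss ! (j - 1)))"
    using adm unfolding admissible_decomposition_def I_def s_def Let_def by blast
  then obtain Y where Y: "\<And>i. i \<in> I \<Longrightarrow> is_segmentation n1 n2 b S (P i) (Y i) \<and> length (Y i) = s i + 1
      \<and> (\<forall>j\<in>{1..s i + 1}. d i j = length (Y i ! (j - 1)))"
    unfolding bchoice_iff by blast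
  have seg: "is_segmentation n1 n2 b S (P i) (Y i)" and lenY: "length (Y i) = s i + 1" if "i \<in> I" for i
    using Y[OF that] by blast+
  have d: "length (Y i ! j) = d i (Suc j)" if "i \<in> I" "j \<le> s i" for i j
    using Y[OF that(1)] that(2) by (auto dest: bspec[of _ _ "Suc j"])
  have Y_ne: "Y i ! j \<noteq> []" if "i \<in> I" "j \<le> s i" for i j
  proof -
    have "Y i ! j \<in> set (Y i)" using lenY[OF that(1)] that(2) by (intro nth_mem) simp
    moreover have "[] \<notin> set (Y i)" using seg[OF that(1)] by (simp add: is_segmentation_def)
    ultimately show ?thesis by metis
  qed
  have u': "2 \<le> u i j \<and> u i j + 2 \<le> d i j" if "i \<in> I" "j \<in> {2..s i}" for i j
    using u that unfolding I_def by blast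
  \<comment> \<open>segments are counted from 0 here, so segment \<open>j\<close> has the parameters \<open>u i (Suc j)\<close> and \<open>d i (Suc j)\<close>\<close>
  define A where "A i j = (if j = s i then Y i ! j else take (u i (Suc j)) (Y i ! j))" for i j
  define B where "B i j = (if j = 0 then Y i ! j else drop (u i (Suc j)) (Y i ! j))" for i j
  have cut: "2 \<le> u i (Suc j) \<and> u i (Suc j) + 2 \<le> length (Y i ! j)" if "i \<in> I" "1 \<le> j" "j < s i" for i j
    using u'[OF that(1), of "Suc j"] d[of i j] that by simp
  have A_ne: "A i j \<noteq> []" and A_len: "length (A i j) = (if j = s i then d i (s i + 1) else u i (Suc j))"
    if "i \<in> I" "1 \<le> j" "j \<le> s i" for i j
    using cut[OF that(1,2)] that Y_ne[OF that(1,3)] d[OF that(1,3)] by (auto simp: A_def)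
  have B_ne: "B i j \<noteq> []"
    and B_len: "length (B i j) = (if j = 0 then d i 1 else d i (Suc j) - u i (Suc j))"
    if "i \<in> I" "j < s i" for i j
    using cut[OF that(1) _ that(2)] that Y_ne[of i j] d[of i j] by (cases j; force simp: B_def)+
  have A_split: "Y i ! j = A i j @ (if j = s i then [] else drop (u i (Suc j)) (Y i ! j))" for i j
    by (simp add: A_def)
  have B_split: "Y i ! j = (if j = 0 then [] else take (u i (Suc j)) (Y i ! j)) @ B i j" for i j
    by (simp add: B_def)
  \<comment> \<open>the ray \<open>(i, j, c)\<close> leaves the edge between the segments \<open>j - 1\<close> and \<open>j\<close>, forwards if \<open>c\<close> holds and backwards otherwise\<close>
  define R where "R = (SIGMA i:I. {1..s i} \<times> (UNIV :: bool set))"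
  define v where "v = (\<lambda>(i, j, c). if c then last (Y i ! (j - 1)) else hd (Y i ! j))"
  define ys where "ys = (\<lambda>(i, j, c). if c then A i j else rev (B i (j - 1)))"
  have rays: "tpath (v r # ys r) \<and> edges_of (v r # ys r) \<subseteq> edges_of (P (fst r)) \<and> edges_of (ys r) \<inter> S = {}
      \<and> ys r \<noteq> [] \<and> {v r, hd (ys r)} = {last (Y (fst r) ! (fst (snd r) - 1)), hd (Y (fst r) ! fst (snd r))}"
    if "r \<in> R" for r
  proof -
    obtain i j c where r: "r = (i, j, c)" by (cases r)
    then have ij: "i \<in> I" "1 \<le> j" "j \<le> s i" using that by (auto simp: R_def)
    then obtain k where k: "j = Suc k" by (cases j) auto
    have k_less: "Suc k < length (Y i)" "k < s i" using ij k lenY by auto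
    note rays = junction_rays[OF pathP[OF ij(1)] seg[OF ij(1)] k_less(1) B_split B_ne[OF ij(1) k_less(2)]
        A_split A_ne[OF ij(1), of "Suc k"]]
    have hdA: "hd (A i (Suc k)) = hd (Y i ! Suc k)"
      using arg_cong[OF A_split[of i "Suc k"], of hd] A_ne[OF ij] k by (simp add: hd_append)
    have hdB: "hd (rev (B i k)) = last (Y i ! k)"
      using arg_cong[OF B_split[of i k], of last] B_ne[OF ij(1) k_less(2)] by (simp add: hd_rev last_append)
    show ?thesis
    proof (cases c)
      case True
      then show ?thesis using rays(1-3) hdA A_ne[OF ij] ij k by (simp add: r v_def ys_def)
    next
      case False
      then show ?thesis using rays(4-6) hdB B_ne[OF ij(1) k_less(2)] ij k
        by (simp add: r v_def ys_def insert_commute)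
    qed
  qed
  have finR: "finite R" by (simp add: R_def I_def)
  have seg_no_S: "edges_of zs \<inter> S = {}" if "i \<in> I" "zs \<in> set (Y i)" for i zs
    using seg[OF that(1)] that(2) unfolding is_segmentation_def by blast
  have head: "\<exists>e\<in>S. {v r, hd (ys r)} = {par e, e}" if "r \<in> R" for r
  proof -
    obtain i j c where r: "r = (i, j, c)" by (cases r)
    then have ij: "i \<in> I" "1 \<le> j" "j \<le> s i" using that by (auto simp: R_def)
    then have "Suc (j - 1) < length (Y i)" using lenY by auto
    then have "\<exists>e\<in>S. {last (Y i ! (j - 1)), hd (Y i ! Suc (j - 1))} = {par e, e}"
      using seg[OF ij(1)] unfolding is_segmentation_def by blast
    then show ?thesis using rays[OF that] ij by (simp add: r)
  qed
  have disj: "disjoint_family_on (\<lambda>r. set (ys r)) R"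
    unfolding disjoint_family_on_def
  proof (intro ballI impI)
    fix r r' assume rr: "r \<in> R" "r' \<in> R" "r \<noteq> r'"
    \<comment> \<open>the segment that contains the ray\<close>
    define pos where "pos = (\<lambda>(i :: nat, j, c). if c then j else j - Suc 0)"
    have in_seg: "set (ys r) \<subseteq> set (Y (fst r) ! pos r) \<and> pos r < length (Y (fst r))" if "r \<in> R" for r
    proof -
      obtain i j c where r: "r = (i, j, c)" by (cases r)
      then have ij: "i \<in> I" "1 \<le> j" "j \<le> s i" using that by (auto simp: R_def)
      show ?thesis using ij lenY[OF ij(1)]
        by (auto simp: r ys_def pos_def A_def B_def dest: in_set_takeD in_set_dropD)
    qed
    have fstI: "fst r \<in> I" "fst r' \<in> I" using rr by (auto simp: R_def)
    have in_P: "set (Y i ! k) \<subseteq> set (P i)" if "i \<in> I" "k < length (Y i)" for i k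
    proof -
      have "concat (Y i) = P i" using seg[OF that(1)] by (simp add: is_segmentation_def)
      moreover have "set (Y i ! k) \<subseteq> set (concat (Y i))" using nth_mem[OF that(2)] by auto
      ultimately show ?thesis by simp
    qed
    have dist: "distinct (concat (Y i))" if "i \<in> I" for i
      using seg[OF that] pathP[OF that] unfolding is_segmentation_def is_path_def by simp
    consider "fst r \<noteq> fst r'" | "fst r = fst r'" "pos r \<noteq> pos r'" | "fst r = fst r'" "pos r = pos r'"
      by blast
    then show "set (ys r) \<inter> set (ys r') = {}"
    proof cases
      case 1
      then have "set (P (fst r)) \<inter> set (P (fst r')) = {}"
        using disjP fstI unfolding disjoint_family_on_def by blast
      then show ?thesis using in_seg[OF rr(1)] in_seg[OF rr(2)] in_P fstI by blast
    next
      case 2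
      have "pos r < length (Y (fst r))" "pos r' < length (Y (fst r))"
        using in_seg[OF rr(1)] in_seg[OF rr(2)] 2 by auto
      then have "set (Y (fst r) ! pos r) \<inter> set (Y (fst r) ! pos r') = {}"
        by (rule distinct_concat_disjoint[OF dist[OF fstI(1)] _ _ 2(2)])
      then show ?thesis using in_seg[OF rr(1)] in_seg[OF rr(2)] 2 by auto
    next
      case 3
      obtain i j c j' c' where r: "r = (i, j, c)" "r' = (i, j', c')" using 3(1) by (cases r, cases r') auto
      have ij: "i \<in> I" "1 \<le> j" "j \<le> s i" "1 \<le> j'" "j' \<le> s i" using rr r by (auto simp: R_def)
      have cc: "c \<noteq> c'" using 3(2) rr(3) ij by (auto simp: r pos_def split: if_splits)
      define k where "k = pos r"
      have k: "1 \<le> k" "k < s i" "{set (ys r), set (ys r')} = {set (A i k), set (B i k)}"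
        using cc 3(2) ij by (cases c; auto simp: k_def r pos_def ys_def)+
      have "set (A i k) \<inter> set (B i k) = {}"
      proof -
        have "distinct (Y i ! k)" using dist[OF ij(1)] lenY[OF ij(1)] k nth_mem[of k "Y i"]
          unfolding distinct_concat_iff by auto
        then show ?thesis using k by (simp add: A_def B_def set_take_disj_set_drop_if_distinct)
      qed
      then show ?thesis using k(3) unfolding doubleton_eq_iff by auto
    qed
  qed
  have conn: "edges_of (v r # ys r) \<inter> C = {}" if "r \<in> R" for r
  proof -
    have "fst r \<in> I" using that by (auto simp: R_def)
    then have "edges_of (P (fst r)) \<inter> C = {}" unfolding C_def connecting_edges_def I_def by blast
    then show ?thesis using rays[OF that] by blast
  qed
  have covered: "(\<exists>r\<in>R. v r = par e \<and> hd (ys r) = e) \<and> (\<exists>r\<in>R. v r = e \<and> hd (ys r) = par e)"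
    if "e \<in> S" for e
  proof -
    have "e \<in> {2..n}" "e \<notin> C" using that S_edges CS by auto
    then obtain i where i: "i \<in> I" "e \<in> edges_of (P i)"
      unfolding C_def connecting_edges_def I_def by blast
    have "P i = concat (Y i)" "[] \<notin> set (Y i)" using seg[OF i(1)] by (auto simp: is_segmentation_def)
    then have "(\<exists>zs\<in>set (Y i). e \<in> edges_of zs)
        \<or> (\<exists>j. Suc j < length (Y i) \<and> {last (Y i ! j), hd (Y i ! Suc j)} = {par e, e})"
      using i(2) by (intro path_edges_concat) simp_all
    moreover have "\<not> (\<exists>zs\<in>set (Y i). e \<in> edges_of zs)" using seg_no_S[OF i(1)] that by blast
    ultimately obtain j where j: "Suc j < length (Y i)" "{last (Y i ! j), hd (Y i ! Suc j)} = {par e, e}"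
      by blast
    have R: "(i, Suc j, True) \<in> R" "(i, Suc j, False) \<in> R" using i(1) j(1) lenY by (auto simp: R_def)
    have "{v (i, Suc j, True), hd (ys (i, Suc j, True))} = {par e, e}"
      "{v (i, Suc j, False), hd (ys (i, Suc j, False))} = {par e, e}"
      using rays[OF R(1)] rays[OF R(2)] j(2) by simp_all
    moreover have "v (i, Suc j, True) = last (Y i ! j)" "v (i, Suc j, False) = hd (Y i ! Suc j)"
      by (simp_all add: v_def)
    moreover have "par e \<noteq> e" using par_less[OF \<open>e \<in> {2..n}\<close>] by simp
    ultimately show ?thesis using R j(2) unfolding doubleton_eq_iff by metis
  qed
  have K: "(\<Sum>r\<in>R. 1 / real (length (ys r))) = K_branch s d u"
  proof -
    have "(\<Sum>r\<in>R. 1 / real (length (ys r)))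
        = (\<Sum>i\<in>I. \<Sum>j\<in>{1..s i}. \<Sum>c\<in>UNIV. 1 / real (length (ys (i, j, c))))"
      unfolding R_def by (simp add: sum.Sigma I_def sum.cartesian_product)
    also have "\<dots> = (\<Sum>i\<in>I. 1 / real (d i 1)
        + (\<Sum>j\<in>{2..s i}. 1 / real (u i j) + 1 / (real (d i j) - real (u i j))) + 1 / real (d i (s i + 1)))"
    proof (rule sum.cong[OF refl])
      fix i assume i: "i \<in> I"
      have "(\<Sum>j\<in>{1..s i}. \<Sum>c\<in>UNIV. 1 / real (length (ys (i, j, c))))
          = (\<Sum>j\<in>{1..s i}. (if j = s i then 1 / real (d i (s i + 1)) else 1 / real (u i (Suc j)))
              + (if j = 1 then 1 / real (d i 1) else 1 / (real (d i j) - real (u i j))))"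
      proof (rule sum.cong[OF refl])
        fix j assume "j \<in> {1..s i}"
        then obtain k where k: "j = Suc k" "Suc k \<le> s i" by (cases j) auto
        have "real (d i (Suc k) - u i (Suc k)) = real (d i (Suc k)) - real (u i (Suc k))" if "k \<noteq> 0"
          using u'[OF i, of "Suc k"] k that by (intro of_nat_diff) simp
        then show "(\<Sum>c\<in>UNIV. 1 / real (length (ys (i, j, c))))
            = (if j = s i then 1 / real (d i (s i + 1)) else 1 / real (u i (Suc j)))
              + (if j = 1 then 1 / real (d i 1) else 1 / (real (d i j) - real (u i j)))"
          using A_len[OF i, of j] B_len[OF i, of k] k by (simp add: UNIV_bool ys_def)
      qed
      also have "\<dots> = 1 / real (d i 1)
        + (\<Sum>j\<in>{2..s i}. 1 / real (u i j) + 1 / (real (d i j) - real (u i j))) + 1 / real (d i (s i + 1))"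
        by (rule sum_front_back[OF s1[OF i]])
      finally show "(\<Sum>j\<in>{1..s i}. \<Sum>c\<in>UNIV. 1 / real (length (ys (i, j, c)))) = 1 / real (d i 1)
        + (\<Sum>j\<in>{2..s i}. 1 / real (u i j) + 1 / (real (d i j) - real (u i j))) + 1 / real (d i (s i + 1))" .
    qed
    finally show ?thesis by (simp only: K_branch_def I_def)
  qed
  have "S \<noteq> {}"
  proof
    assume "S = {}"
    then have "s 1 = 0" by (simp add: s_def S_part_def)
    then show False using s1[of 1] by (simp add: I_def)
  qed
  then show ?thesis
    unfolding K[symmetric] using rays head conn disj covered
    by (intro ray_family_bound[OF finR]) blast+
qed

end

section \<open>The minimum defining the compatibility constant is attained\<close>

context weighted_branched_path
begin

abbreviation "constraint \<beta> \<equiv> (\<Sum>j\<in>S. \<bar>w j * \<beta> j\<bar>) - (\<Sum>j\<in>{1..n} - ({1} \<union> S). \<bar>w j * \<beta> j\<bar>)"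

lemma compact_box: "compact {\<beta> :: nat \<Rightarrow> real. \<forall>i. \<beta> i \<in> {- m..m}}"
proof -
  have "compactin (product_topology (\<lambda>i::nat. euclidean :: real topology) UNIV) (\<Pi>\<^sub>E i\<in>UNIV. {- m..m})"
    by (simp add: compactin_PiE)
  moreover have "(\<Pi>\<^sub>E i\<in>UNIV. {- m..m}) = {\<beta> :: nat \<Rightarrow> real. \<forall>i. \<beta> i \<in> {- m..m}}"
    by (auto simp: PiE_UNIV_domain)
  ultimately show ?thesis by (simp add: euclidean_product_topology)
qed

lemma coefficient_bound:
  assumes "i \<in> {1..n}"
  shows "\<bar>\<beta> i\<bar> \<le> 2 * sqrt (real n * sq_norm_n n (mat_vec n X \<beta>))"
proof -
  define m where "m = sqrt (real n * sq_norm_n n (mat_vec n X \<beta>))"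
  have m: "\<bar>mat_vec n X \<beta> k\<bar> \<le> m" if "k \<in> {1..n}" for k
  proof -
    have "(mat_vec n X \<beta> k)\<^sup>2 \<le> (\<Sum>i\<in>{1..n}. (mat_vec n X \<beta> i)\<^sup>2)"
      using that by (intro member_le_sum) auto
    also have "\<dots> = real n * sq_norm_n n (mat_vec n X \<beta>)"
      using n_pos by (simp add: sq_norm_n_def)
    finally show ?thesis unfolding m_def by (intro real_le_rsqrt) simp
  qed
  show ?thesis
  proof (cases "i = 1")
    case True
    have "1 \<in> {1..n}" using n2_ge_1 by simp
    then have "\<bar>\<beta> 1\<bar> \<le> m" using m[of 1] by (simp only: path_mat_root)
    moreover have "0 \<le> m" using calculation by linarith
    ultimately show ?thesis using True unfolding m_def[symmetric] by simp
  next
    case False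
    then have i: "i \<in> {2..n}" using assms by auto
    have "\<bar>\<beta> i\<bar> \<le> \<bar>mat_vec n X \<beta> i\<bar> + \<bar>mat_vec n X \<beta> (par i)\<bar>"
      unfolding path_mat_increment[OF i, of \<beta>, symmetric] by (rule abs_triangle_ineq4)
    then show ?thesis using m[OF assms] m[OF par_in[OF i]] unfolding m_def[symmetric] by linarith
  qed
qed

text \<open>
  A feasible vector exists because the weights are \<open>1\<close> on \<open>S\<close>. By \<open>coefficient_bound\<close> the feasible
  vectors that are at least as good as this one have bounded coefficients; setting the coordinates
  outside \<open>{1..n}\<close> to zero, they lie in a box, which is compact in the product topology by Tychonoff's
  theorem, and a continuous function attains its minimum on it.
\<close>

lemma kappa_sq_attained:
  assumes "S \<noteq> {}"
  obtains \<beta> where "constraint \<beta> = 1"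
    "kappa_sq n1 n2 b w S = (real (card S) + 1) * sq_norm_n n (mat_vec n X \<beta>)"
proof -
  define \<Phi> where "\<Phi> \<beta> = sq_norm_n n (mat_vec n X \<beta>)" for \<beta>
  obtain j0 where j0: "j0 \<in> S" using assms by blast
  define \<beta>0 :: "nat \<Rightarrow> real" where "\<beta>0 j = (if j = j0 then 1 else 0)" for j
  have feas0: "constraint \<beta>0 = 1"
  proof -
    have "(\<Sum>j\<in>S. \<bar>w j * \<beta>0 j\<bar>) = (\<Sum>j\<in>S. if j = j0 then 1 else 0)"
      using j0 by (intro sum.cong refl) (simp add: \<beta>0_def weight_S)
    moreover have "(\<Sum>j\<in>{1..n} - ({1} \<union> S). \<bar>w j * \<beta>0 j\<bar>) = 0"
      using j0 by (intro sum.neutral ballI) (auto simp: \<beta>0_def)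
    ultimately show ?thesis using j0 finite_S by simp
  qed
  define m where "m = 2 * sqrt (real n * \<Phi> \<beta>0)"
  define F where "F = {\<beta> :: nat \<Rightarrow> real. \<forall>i. \<beta> i \<in> {- m..m}} \<inter> {\<beta>. constraint \<beta> = 1}"
  have coord [continuous_intros]: "continuous_on T (\<lambda>\<beta> :: nat \<Rightarrow> real. \<beta> i)" for T i
    by (rule continuous_on_subset[OF continuous_on_product_coordinates]) simp
  have "closed {\<beta>. constraint \<beta> = 1}"
    by (intro closed_Collect_eq continuous_intros)
  then have "compact F" unfolding F_def using compact_box by (rule compact_Int_closed[rotated])
  have restrict: "(\<lambda>i. if i \<in> {1..n} then \<beta> i else 0) \<in> F
      \<and> \<Phi> (\<lambda>i. if i \<in> {1..n} then \<beta> i else 0) = \<Phi> \<beta>"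
    if "constraint \<beta> = 1" "\<Phi> \<beta> \<le> \<Phi> \<beta>0" for \<beta>
  proof
    define \<beta>' where "\<beta>' i = (if i \<in> {1..n} then \<beta> i else 0)" for i
    have eq: "(\<lambda>i. if i \<in> {1..n} then \<beta> i else 0) = \<beta>'"
      unfolding \<beta>'_def by (rule refl)
    have "mat_vec n X \<beta>' = mat_vec n X \<beta>"
      unfolding mat_vec_def by (intro ext sum.cong) (simp_all add: \<beta>'_def)
    then show "\<Phi> (\<lambda>i. if i \<in> {1..n} then \<beta> i else 0) = \<Phi> \<beta>"
      unfolding eq \<Phi>_def by (rule arg_cong)
    have "(\<Sum>j\<in>S. \<bar>w j * \<beta>' j\<bar>) = (\<Sum>j\<in>S. \<bar>w j * \<beta> j\<bar>)"
      using S_edges by (intro sum.cong refl) (auto simp: \<beta>'_def)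
    moreover have "(\<Sum>j\<in>{1..n} - ({1} \<union> S). \<bar>w j * \<beta>' j\<bar>) = (\<Sum>j\<in>{1..n} - ({1} \<union> S). \<bar>w j * \<beta> j\<bar>)"
      by (intro sum.cong refl) (auto simp: \<beta>'_def)
    ultimately have "constraint \<beta>' = 1" using that(1) by simp
    moreover have "\<beta>' i \<in> {- m..m}" for i
    proof -
      have "2 * sqrt (real n * \<Phi> \<beta>) \<le> m"
        unfolding m_def using that(2) n_pos by simp
      moreover have "0 \<le> 2 * sqrt (real n * \<Phi> \<beta>)"
        by (simp add: \<Phi>_def sq_norm_n_def sum_nonneg)
      ultimately have "0 \<le> m" "2 * sqrt (real n * \<Phi> \<beta>) \<le> m" by linarith+
      then show ?thesis
        using coefficient_bound[of i \<beta>] unfolding \<beta>'_def \<Phi>_def by (auto simp: abs_le_iff)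
    qed
    ultimately show "(\<lambda>i. if i \<in> {1..n} then \<beta> i else 0) \<in> F"
      unfolding eq F_def by blast
  qed
  have "F \<noteq> {}" using restrict[OF feas0] by blast
  moreover have "continuous_on F \<Phi>"
    unfolding \<Phi>_def sq_norm_n_def mat_vec_def by (intro continuous_intros)
  ultimately obtain \<beta> where \<beta>: "\<beta> \<in> F" "\<And>\<alpha>. \<alpha> \<in> F \<Longrightarrow> \<Phi> \<beta> \<le> \<Phi> \<alpha>"
    using continuous_attains_inf[OF \<open>compact F\<close>] by blast
  have min: "\<Phi> \<beta> \<le> \<Phi> \<alpha>" if "constraint \<alpha> = 1" for \<alpha>
  proof (cases "\<Phi> \<alpha> \<le> \<Phi> \<beta>0")
    case True
    then show ?thesis using restrict[OF that] \<beta>(2) by metis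
  next
    case False
    then show ?thesis using restrict[OF feas0] \<beta>(2) by (metis linear order_trans)
  qed
  have con: "constraint \<beta> = 1" using \<beta>(1) by (simp add: F_def)
  show thesis
  proof (rule that[OF con])
    show "kappa_sq n1 n2 b w S = (real (card S) + 1) * sq_norm_n n (mat_vec n X \<beta>)"
      unfolding kappa_sq_def
    proof (rule Least_equality)
      show "\<exists>\<beta>'. constraint \<beta>' = 1 \<and> (real (card S) + 1) * sq_norm_n n (mat_vec n X \<beta>)
          = (real (card S) + 1) * sq_norm_n n (mat_vec n X \<beta>')"
        using con by (intro exI[of _ \<beta>] conjI refl)
    next
      fix r assume "\<exists>\<beta>'. constraint \<beta>' = 1 \<and> r = (real (card S) + 1) * sq_norm_n n (mat_vec n X \<beta>')"
      then obtain \<alpha> where "constraint \<alpha> = 1" "r = (real (card S) + 1) * sq_norm_n n (mat_vec n X \<alpha>)"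
        by (elim exE conjE)
      then show "(real (card S) + 1) * sq_norm_n n (mat_vec n X \<beta>) \<le> r"
        using min[of \<alpha>] by (simp add: \<Phi>_def mult_left_mono)
    qed
  qed
qed

end

section \<open>The bound on the compatibility constant\<close>

lemma K_branch_pos:
  assumes "\<And>i. i \<in> {1, 2, 3} \<Longrightarrow> 2 \<le> d i 1"
    and "\<And>i j. i \<in> {1, 2, 3} \<Longrightarrow> j \<in> {2..s i} \<Longrightarrow> u i j \<le> d i j"
  shows "0 < K_branch s d u"
  unfolding K_branch_def
proof (rule sum_pos)
  fix i :: nat assume i: "i \<in> {1, 2, 3}"
  have "0 < 1 / real (d i 1)" using assms(1)[OF i] by simp
  moreover have "0 \<le> (\<Sum>j\<in>{2..s i}. 1 / real (u i j) + 1 / (real (d i j) - real (u i j)))"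
    using assms(2)[OF i] by (intro sum_nonneg) simp
  moreover have "0 \<le> 1 / real (d i (s i + 1))" by simp
  ultimately show "0 < 1 / real (d i 1)
      + (\<Sum>j\<in>{2..s i}. 1 / real (u i j) + 1 / (real (d i j) - real (u i j))) + 1 / real (d i (s i + 1))"
    by linarith
qed auto

context weighted_branched_path
begin

lemma sup_norm_weight_ge_1:
  assumes "S \<noteq> {}"
  shows "1 \<le> sup_norm n w"
proof -
  obtain j where j: "j \<in> S" using assms by blast
  then have "\<bar>w j\<bar> \<le> sup_norm n w"
    unfolding sup_norm_def using S_edges by (intro Max_ge) auto
  then show ?thesis using weight_S[OF j] by simp
qed

text \<open>
  The bound for sums of increments is applied to \<open>f = X \<beta>\<close> with a minimiser \<open>\<beta>\<close>. The factor
  \<open>sup_norm n w \<ge> 1\<close> enters only by enlarging \<open>sqrt K\<close>. The other two inequalities are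
  \<open>(x + y)\<^sup>2 \<le> 2 * (x\<^sup>2 + y\<^sup>2)\<close> and the fact that the norm of \<open>D w\<close> has more summands than that of \<open>D* w\<close>.
\<close>

lemma compatibility_bounds:
  fixes P :: "nat \<Rightarrow> nat list" and d u :: "nat \<Rightarrow> nat \<Rightarrow> nat"
  defines "s \<equiv> (\<lambda>i. card (S_part n1 n2 b S i))" and "C \<equiv> connecting_edges n1 n2 b P"
  assumes adm: "admissible_decomposition n1 n2 b S P d"
    and u: "\<forall>i\<in>{1,2,3}. \<forall>j\<in>{2..s i}. 2 \<le> u i j \<and> u i j + 2 \<le> d i j"
  defines "K \<equiv> K_branch s d u" and "W \<equiv> sup_norm n w"
    and "Ds \<equiv> L2_set (mat_vec n (zero_rows C (inc_mat n1 b)) w) {2..n}"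
    and "Dw \<equiv> L2_set (mat_vec n (inc_mat n1 b) w) {2..n}"
  shows "(real (card S) + 1) / real n * (1 / (sqrt K * W + Ds)\<^sup>2) \<le> kappa_sq n1 n2 b w S"
    and "(real (card S) + 1) / real n * (1 / (2 * (K * W\<^sup>2 + Ds\<^sup>2)))
      \<le> (real (card S) + 1) / real n * (1 / (sqrt K * W + Ds)\<^sup>2)"
    and "(real (card S) + 1) / real n * (1 / (2 * (K * W\<^sup>2 + Dw\<^sup>2)))
      \<le> (real (card S) + 1) / real n * (1 / (2 * (K * W\<^sup>2 + Ds\<^sup>2)))"
proof -
  have Sne: "S \<noteq> {}"
  proof
    assume "S = {}"
    then have "card (S_part n1 n2 b S 1) = 0" by (simp add: S_part_def)
    moreover have "card (S_part n1 n2 b S 1) \<ge> 1"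
      using adm unfolding admissible_decomposition_def Let_def by blast
    ultimately show False by linarith
  qed
  have W1: "1 \<le> W" unfolding W_def by (rule sup_norm_weight_ge_1[OF Sne])
  have K0: "0 < K"
    unfolding K_def
  proof (rule K_branch_pos)
    show "2 \<le> d i 1" if "i \<in> {1, 2, 3}" for i
      using adm that unfolding admissible_decomposition_def Let_def by blast
    show "u i j \<le> d i j" if "i \<in> {1, 2, 3}" "j \<in> {2..s i}" for i j
      using bspec[OF bspec[OF u that(1)] that(2)] by linarith
  qed
  have Ds0: "0 \<le> Ds" by (simp add: Ds_def)
  define G where "G = sqrt K * W + Ds"
  have G0: "0 < G" unfolding G_def using K0 W1 Ds0 by (intro add_pos_nonneg mult_pos_pos) auto
  have factor: "0 \<le> (real (card S) + 1) / real n" by simp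
  obtain \<beta> where \<beta>: "constraint \<beta> = 1"
    and kappa: "kappa_sq n1 n2 b w S = (real (card S) + 1) * sq_norm_n n (mat_vec n X \<beta>)"
    using kappa_sq_attained[OF Sne] by blast
  define f where "f = mat_vec n X \<beta>"
  have inc: "f j - f (par j) = \<beta> j" if "j \<in> {2..n}" for j
    unfolding f_def by (rule path_mat_increment[OF that])
  define F where "F = (\<Sum>i\<in>{1..n}. (f i)\<^sup>2)"
  have F0: "0 \<le> F" by (simp add: F_def sum_nonneg)
  have "{1..n} - ({1} \<union> S) = {2..n} - S" by auto
  then have "1 = (\<Sum>j\<in>S. \<bar>w j * \<beta> j\<bar>) - (\<Sum>j\<in>{2..n} - S. \<bar>w j * \<beta> j\<bar>)"
    using \<beta> by simp
  also have "\<dots> = (\<Sum>j\<in>S. \<bar>w j * (f j - f (par j))\<bar>) - (\<Sum>j\<in>{2..n} - S. \<bar>w j * (f j - f (par j))\<bar>)"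
  proof -
    have "(\<Sum>j\<in>T. \<bar>w j * \<beta> j\<bar>) = (\<Sum>j\<in>T. \<bar>w j * (f j - f (par j))\<bar>)" if "T \<subseteq> {2..n}" for T
    proof (rule sum.cong[OF refl])
      fix j assume "j \<in> T"
      then have "j \<in> {2..n}" using that by blast
      then show "\<bar>w j * \<beta> j\<bar> = \<bar>w j * (f j - f (par j))\<bar>" by (simp only: inc)
    qed
    from this[OF S_edges] this[of "{2..n} - S"] show ?thesis by simp
  qed
  also have "\<dots> \<le> (sqrt K + Ds) * sqrt F"
    using admissible_bound[OF adm u[unfolded s_def], of f] unfolding K_def s_def Ds_def C_def F_def .
  also have "\<dots> \<le> G * sqrt F"
  proof (rule mult_right_mono)
    have "sqrt K * 1 \<le> sqrt K * W" using K0 W1 by (intro mult_left_mono) auto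
    then show "sqrt K + Ds \<le> G" by (simp add: G_def)
  qed (simp add: F0)
  finally have "1 \<le> G * sqrt F" .
  then have "1\<^sup>2 \<le> (G * sqrt F)\<^sup>2" by (rule power_mono) simp
  then have "1 \<le> G\<^sup>2 * F" using F0 by (simp add: power_mult_distrib)
  then have "1 / G\<^sup>2 \<le> F" using G0 by (simp add: divide_le_eq mult.commute)
  then have "(real (card S) + 1) / real n * (1 / G\<^sup>2) \<le> (real (card S) + 1) / real n * F"
    by (rule mult_left_mono[OF _ factor])
  also have "\<dots> = kappa_sq n1 n2 b w S"
    by (simp add: kappa sq_norm_n_def F_def f_def)
  finally show "(real (card S) + 1) / real n * (1 / (sqrt K * W + Ds)\<^sup>2) \<le> kappa_sq n1 n2 b w S"
    unfolding G_def .
  have "G\<^sup>2 \<le> 2 * ((sqrt K * W)\<^sup>2 + Ds\<^sup>2)"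
    unfolding G_def using sum_squares_ge_zero[of "sqrt K * W - Ds" 0]
    by (simp add: power2_sum power2_eq_square algebra_simps)
  also have "(sqrt K * W)\<^sup>2 = K * W\<^sup>2" using K0 by (simp add: power_mult_distrib)
  finally have "1 / (2 * (K * W\<^sup>2 + Ds\<^sup>2)) \<le> 1 / G\<^sup>2"
    using G0 by (intro frac_le) auto
  then show "(real (card S) + 1) / real n * (1 / (2 * (K * W\<^sup>2 + Ds\<^sup>2)))
      \<le> (real (card S) + 1) / real n * (1 / (sqrt K * W + Ds)\<^sup>2)"
    unfolding G_def by (rule mult_left_mono[OF _ factor])
  have "zero_rows {} M = M" for M by (simp add: zero_rows_def fun_eq_iff)
  then have "Dw\<^sup>2 = (\<Sum>e\<in>{2..n}. (w e - w (par e))\<^sup>2)"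
    using Dstar_norm_sq[of "{}" w] by (simp add: Dw_def)
  then have "Ds\<^sup>2 \<le> Dw\<^sup>2"
    unfolding Ds_def Dstar_norm_sq by (simp add: sum_mono2)
  moreover have "0 < K * W\<^sup>2" using K0 W1 by (intro mult_pos_pos zero_less_power) auto
  ultimately have "1 / (2 * (K * W\<^sup>2 + Dw\<^sup>2)) \<le> 1 / (2 * (K * W\<^sup>2 + Ds\<^sup>2))"
    by (intro frac_le) (auto intro: add_pos_nonneg)
  then show "(real (card S) + 1) / real n * (1 / (2 * (K * W\<^sup>2 + Dw\<^sup>2)))
      \<le> (real (card S) + 1) / real n * (1 / (2 * (K * W\<^sup>2 + Ds\<^sup>2)))"
    by (rule mult_left_mono[OF _ factor])
qed

end

theorem lemma5p3:
  fixes n1 n2 b n :: nat and S :: "nat set" and \<gamma> :: real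
    and P :: "nat \<Rightarrow> nat list" and d u :: "nat \<Rightarrow> nat \<Rightarrow> nat"
    and s :: "nat \<Rightarrow> nat" and D Dstar :: "nat \<Rightarrow> nat \<Rightarrow> real" and w :: "nat \<Rightarrow> real"
    and norm_Dw norm_Dstar_w K :: real
  defines "n \<equiv> n1 + n2"
    and "s \<equiv> (\<lambda>i. card (S_part n1 n2 b S i))"
    and "D \<equiv> inc_mat n1 b"
    and "Dstar \<equiv> zero_rows (connecting_edges n1 n2 b P) D"
    and "w \<equiv> weight n1 n2 b S \<gamma>"
    and "norm_Dw \<equiv> L2_set (mat_vec n D w) {2..n}"
    and "norm_Dstar_w \<equiv> L2_set (mat_vec n Dstar w) {2..n}"
    and "K \<equiv> K_branch s d u"
  assumes "1 \<le> b" and "b < n1" and "1 \<le> n2"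
    and "S \<subseteq> {2..n}"
    and "\<gamma> > 1"
    and "admissible_decomposition n1 n2 b S P d"
    and "\<forall>i\<in>{1,2,3}. \<forall>j\<in>{2..s i}. 2 \<le> u i j \<and> u i j + 2 \<le> d i j"
  shows "kappa_sq n1 n2 b w S
           \<ge> (real (card S) + 1) / real n * (1 / (sqrt K * sup_norm n w + norm_Dstar_w)\<^sup>2) \<and>
         (real (card S) + 1) / real n * (1 / (sqrt K * sup_norm n w + norm_Dstar_w)\<^sup>2)
           \<ge> (real (card S) + 1) / real n * (1 / (2 * (K * (sup_norm n w)\<^sup>2 + norm_Dstar_w\<^sup>2))) \<and>
         (real (card S) + 1) / real n * (1 / (2 * (K * (sup_norm n w)\<^sup>2 + norm_Dstar_w\<^sup>2)))
           \<ge> (real (card S) + 1) / real n * (1 / (2 * (K * (sup_norm n w)\<^sup>2 + norm_Dw\<^sup>2)))"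
proof -
  have tree: "weighted_branched_path n1 n2 b S \<gamma>"
    using assms(9-13) unfolding n_def by unfold_locales
  note bounds = weighted_branched_path.compatibility_bounds[OF tree assms(14) assms(15)[unfolded s_def]]
  show ?thesis
    unfolding n_def s_def D_def Dstar_def w_def norm_Dw_def norm_Dstar_w_def K_def
    using bounds by blast
qed

end
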